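(* Let $(M,g)$ be a Riemannian or pseudo-Riemannian manifold of dimension $n$ with Levi-Civita connection $\nabla$ and scalar curvature $r$, let $\rho$ be a vector field on $M$ with $\pi(X)=g(X,\rho)$, and let $\bar\nabla$ be the semi-symmetric metric connection $\bar\nabla_XY=\nabla_XY+\pi(Y)X-g(X,Y)\rho$. Let $(g,\tau,\lambda)$ be a conformal Yamabe soliton on $M$ with respect to $\bar\nabla$, with scalar field $p$. Then the vector field $\tau$ is torse-forming (that is, $\nabla_X\tau=\phi X+\alpha(X)\tau$ for all vector fields $X$, with $\phi$ a smooth function and $\alpha$ a 1-form) if $$\lambda=r-\phi-2(n-1)a+\frac12\Big(p+\frac2n\Big)-\frac{n-1}{n}\pi(\tau)-\frac{\alpha(\tau)}{n}$$ is constant, and the soliton is expanding, steady or shrinking according as $r-\phi-2(n-1)a+\frac12\big(p+\frac2n\big)-\frac{n-1}{n}\pi(\tau)-\frac{\alpha(\tau)}{n}$ is $>0$, $=0$ or $<0$. Here $a=\operatorname{Tr}(P)$ is the trace of the $(0,2)$-tensor field $P(X,Y)=(\nabla_X\pi)(Y)-\pi(X)\pi(Y)+\frac12\pi(\rho)g(X,Y)$.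
   Context: A triple $(g,\tau,\lambda)$ is a conformal Yamabe soliton on $M$ with respect to $\bar\nabla$ if, for all vector fields $X,Y$, $$(\bar{\pounds}_\tau g)(X,Y)+\Big[2\lambda-2\bar r-\Big(p+\frac2n\Big)\Big]g(X,Y)=0,$$ where $(\bar{\pounds}_\tau g)(X,Y)=g(\bar\nabla_X\tau,Y)+g(X,\bar\nabla_Y\tau)$ is the Lie derivative along $\tau$ with respect to $\bar\nabla$, $\bar r$ is the scalar curvature associated with $\bar\nabla$, given by $\bar r=r-2(n-1)a$, $\lambda$ is a constant, $p$ is a scalar non-dynamical field (time-dependent scalar field), and $n=\dim M$. The soliton is called expanding, steady or shrinking according as $\lambda$ is positive, zero or negative. A nowhere vanishing vector field $\tau$ is called torse-forming if $\nabla_X\tau=\phi X+\alpha(X)\tau$ (with $\nabla$ the Levi-Civita connection), where $\phi$ is a smooth function and $\alpha$ is a 1-form; these are the $\phi$ and $\alpha$ appearing in the claim.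
   Formalization: The literal "torse-forming if λ = …" is false (flat R⁴∖{0}, ρ=0, τ=Jx, p=−1/2, λ=φ=α=0); instead τ is assumed torse-forming with the given φ and α, and the formula for λ, its constancy and the expanding/steady/shrinking criterion are proved. *)

theory Defs
  imports "HOL-Analysis.Analysis"
begin

section \<open>Smooth maps between normed spaces\<close>

text \<open>For open \<open>S\<close> in a finite-dimensional space, \<open>Ck_on k f S\<close> says that \<open>f\<close> is of class
  \<open>C\<^sup>k\<close> on \<open>S\<close>: directional derivatives of all orders up to \<open>k\<close> exist in the Frechet sense
  and are continuous.\<close>

primrec Ck_on :: "nat \<Rightarrow> ('a::real_normed_vector \<Rightarrow> 'b::real_normed_vector) \<Rightarrow> 'a set \<Rightarrow> bool" where
  "Ck_on 0 f S \<longleftrightarrow> continuous_on S f"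
| "Ck_on (Suc k) f S \<longleftrightarrow>
     (\<forall>x\<in>S. f differentiable (at x)) \<and>
     (\<forall>v. Ck_on k (\<lambda>x. frechet_derivative f (at x) v) S)"

definition smooth_on :: "'a::real_normed_vector set \<Rightarrow> ('a \<Rightarrow> 'b::real_normed_vector) \<Rightarrow> bool" where
  "smooth_on S f \<longleftrightarrow> (\<forall>k. Ck_on k f S)"


section \<open>Smooth manifolds\<close>

text \<open>The underlying set of a manifold is a whole (Hausdorff, second countable) type \<open>'m\<close>;
  its dimension is \<open>CARD('n)\<close>.  A chart is a pair of a domain and a coordinate map.\<close>

type_synonym ('m, 'n) chart = "'m set \<times> ('m \<Rightarrow> real ^ 'n)"

abbreviation chart_dom :: "('m, 'n::finite) chart \<Rightarrow> 'm set" where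
  "chart_dom c \<equiv> fst c"

abbreviation chart_map :: "('m, 'n::finite) chart \<Rightarrow> 'm \<Rightarrow> real ^ 'n" where
  "chart_map c \<equiv> snd c"

abbreviation chart_range :: "('m, 'n::finite) chart \<Rightarrow> (real ^ 'n) set" where
  "chart_range c \<equiv> chart_map c ` chart_dom c"

definition chart_inv :: "('m, 'n::finite) chart \<Rightarrow> real ^ 'n \<Rightarrow> 'm" where
  "chart_inv c = inv_into (chart_dom c) (chart_map c)"

definition smooth_atlas ::
  "('m::{t2_space, second_countable_topology}, 'n::finite) chart set \<Rightarrow> bool" where
  "smooth_atlas A \<longleftrightarrow>
     (\<forall>c\<in>A. open (chart_dom c) \<and> open (chart_range c) \<and>
        homeomorphism (chart_dom c) (chart_range c) (chart_map c) (chart_inv c)) \<and>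
     (\<Union>c\<in>A. chart_dom c) = UNIV \<and>
     (\<forall>c\<in>A. \<forall>d\<in>A.
        smooth_on (chart_map c ` (chart_dom c \<inter> chart_dom d)) (chart_map d \<circ> chart_inv c))"

text \<open>Every point \<open>q\<close> gets a preferred chart, and the tangent space at \<open>q\<close> is identified with
  \<open>real ^ 'n\<close> through it: the vector \<open>v\<close> stands for the tangent vector at \<open>q\<close> with components
  \<open>v\<close> in the chart \<open>chart_at A q\<close>.  So a section of the tangent bundle is a function
  \<open>'m \<Rightarrow> real ^ 'n\<close>, and linear algebra on a tangent space is linear algebra on
  \<open>real ^ 'n\<close> (whose inner product plays no role).  Since the preferred chart may jump,
  smoothness is not smoothness of that function; components must first be moved to a fixed
  chart.\<close>

definition chart_at :: "('m, 'n::finite) chart set \<Rightarrow> 'm \<Rightarrow> ('m, 'n) chart" where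
  "chart_at A q = (SOME c. c \<in> A \<and> q \<in> chart_dom c)"

text \<open>Components in the chart \<open>c\<close> of the tangent vector \<open>v\<close> at \<open>q\<close>.\<close>

definition tangent_coords ::
  "('m, 'n::finite) chart set \<Rightarrow> ('m, 'n) chart \<Rightarrow> 'm \<Rightarrow> real ^ 'n \<Rightarrow> real ^ 'n" where
  "tangent_coords A c q v =
     frechet_derivative (chart_map c \<circ> chart_inv (chart_at A q))
       (at (chart_map (chart_at A q) q)) v"

definition smooth_function :: "('m, 'n::finite) chart set \<Rightarrow> ('m \<Rightarrow> real) \<Rightarrow> bool" where
  "smooth_function A f \<longleftrightarrow> (\<forall>c\<in>A. smooth_on (chart_range c) (f \<circ> chart_inv c))"

definition vector_field :: "('m, 'n::finite) chart set \<Rightarrow> ('m \<Rightarrow> real ^ 'n) \<Rightarrow> bool" where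
  "vector_field A X \<longleftrightarrow>
     (\<forall>c\<in>A. smooth_on (chart_range c)
        (\<lambda>x. tangent_coords A c (chart_inv c x) (X (chart_inv c x))))"

definition one_form :: "('m, 'n::finite) chart set \<Rightarrow> ('m \<Rightarrow> real ^ 'n \<Rightarrow> real) \<Rightarrow> bool" where
  "one_form A \<alpha> \<longleftrightarrow>
     (\<forall>q. linear (\<alpha> q)) \<and>
     (\<forall>X. vector_field A X \<longrightarrow> smooth_function A (\<lambda>q. \<alpha> q (X q)))"

text \<open>The function \<open>X f\<close>.\<close>

definition vf_apply ::
  "('m, 'n::finite) chart set \<Rightarrow> ('m \<Rightarrow> real ^ 'n) \<Rightarrow> ('m \<Rightarrow> real) \<Rightarrow> 'm \<Rightarrow> real" where
  "vf_apply A X f q =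
     frechet_derivative (f \<circ> chart_inv (chart_at A q)) (at (chart_map (chart_at A q) q)) (X q)"

definition lie_bracket ::
  "('m, 'n::finite) chart set \<Rightarrow> ('m \<Rightarrow> real ^ 'n) \<Rightarrow> ('m \<Rightarrow> real ^ 'n) \<Rightarrow> 'm \<Rightarrow> real ^ 'n" where
  "lie_bracket A X Y =
     (THE Z. vector_field A Z \<and>
        (\<forall>f. smooth_function A f \<longrightarrow>
           vf_apply A Z f =
             (\<lambda>q. vf_apply A X (vf_apply A Y f) q - vf_apply A Y (vf_apply A X f) q)))"

text \<open>Some vector field through a prescribed tangent vector.  It is used only to evaluate at a
  point expressions that are tensorial (linear over the smooth functions) in the fields, so the
  resulting values do not depend on the choice.\<close>

definition extend ::
  "('m, 'n::finite) chart set \<Rightarrow> 'm \<Rightarrow> real ^ 'n \<Rightarrow> 'm \<Rightarrow> real ^ 'n" where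
  "extend A q v = (SOME X. vector_field A X \<and> X q = v)"


section \<open>Metrics, connections, curvature\<close>

text \<open>Riemannian and pseudo-Riemannian metrics: no condition on the signature.\<close>

definition pseudo_riemannian_metric ::
  "('m, 'n::finite) chart set \<Rightarrow> ('m \<Rightarrow> real ^ 'n \<Rightarrow> real ^ 'n \<Rightarrow> real) \<Rightarrow> bool" where
  "pseudo_riemannian_metric A g \<longleftrightarrow>
     (\<forall>q. bilinear (g q) \<and> (\<forall>u v. g q u v = g q v u) \<and>
        (\<forall>u. (\<forall>v. g q u v = 0) \<longrightarrow> u = 0)) \<and>
     (\<forall>X Y. vector_field A X \<longrightarrow> vector_field A Y \<longrightarrow>
        smooth_function A (\<lambda>q. g q (X q) (Y q)))"

type_synonym ('m, 'n) connection =
  "('m \<Rightarrow> real ^ 'n) \<Rightarrow> ('m \<Rightarrow> real ^ 'n) \<Rightarrow> 'm \<Rightarrow> real ^ 'n"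

definition affine_connection ::
  "('m, 'n::finite) chart set \<Rightarrow> ('m, 'n) connection \<Rightarrow> bool" where
  "affine_connection A D \<longleftrightarrow>
     (\<forall>X Y. vector_field A X \<longrightarrow> vector_field A Y \<longrightarrow> vector_field A (D X Y)) \<and>
     (\<forall>X X' Y. vector_field A X \<longrightarrow> vector_field A X' \<longrightarrow> vector_field A Y \<longrightarrow>
        D (\<lambda>q. X q + X' q) Y = (\<lambda>q. D X Y q + D X' Y q)) \<and>
     (\<forall>f X Y. smooth_function A f \<longrightarrow> vector_field A X \<longrightarrow> vector_field A Y \<longrightarrow>
        D (\<lambda>q. f q *\<^sub>R X q) Y = (\<lambda>q. f q *\<^sub>R D X Y q)) \<and>
     (\<forall>X Y Y'. vector_field A X \<longrightarrow> vector_field A Y \<longrightarrow> vector_field A Y' \<longrightarrow>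
        D X (\<lambda>q. Y q + Y' q) = (\<lambda>q. D X Y q + D X Y' q)) \<and>
     (\<forall>f X Y. smooth_function A f \<longrightarrow> vector_field A X \<longrightarrow> vector_field A Y \<longrightarrow>
        D X (\<lambda>q. f q *\<^sub>R Y q) = (\<lambda>q. vf_apply A X f q *\<^sub>R Y q + f q *\<^sub>R D X Y q))"

definition levi_civita ::
  "('m, 'n::finite) chart set \<Rightarrow> ('m \<Rightarrow> real ^ 'n \<Rightarrow> real ^ 'n \<Rightarrow> real) \<Rightarrow>
   ('m, 'n) connection \<Rightarrow> bool" where
  "levi_civita A g D \<longleftrightarrow>
     affine_connection A D \<and>
     (\<forall>X Y. vector_field A X \<longrightarrow> vector_field A Y \<longrightarrow>
        (\<lambda>q. D X Y q - D Y X q) = lie_bracket A X Y) \<and>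
     (\<forall>X Y Z. vector_field A X \<longrightarrow> vector_field A Y \<longrightarrow> vector_field A Z \<longrightarrow>
        vf_apply A X (\<lambda>q. g q (Y q) (Z q)) =
          (\<lambda>q. g q (D X Y q) (Z q) + g q (Y q) (D X Z q)))"

definition curvature ::
  "('m, 'n::finite) chart set \<Rightarrow> ('m, 'n) connection \<Rightarrow> ('m \<Rightarrow> real ^ 'n) \<Rightarrow>
   ('m \<Rightarrow> real ^ 'n) \<Rightarrow> ('m \<Rightarrow> real ^ 'n) \<Rightarrow> 'm \<Rightarrow> real ^ 'n" where
  "curvature A D X Y Z q = D X (D Y Z) q - D Y (D X Z) q - D (lie_bracket A X Y) Z q"

text \<open>\<open>Ric(Y,Z) = Tr(X \<mapsto> R(X,Y)Z)\<close>.\<close>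

definition ricci ::
  "('m, 'n::finite) chart set \<Rightarrow> ('m, 'n) connection \<Rightarrow> 'm \<Rightarrow> real ^ 'n \<Rightarrow> real ^ 'n \<Rightarrow> real" where
  "ricci A D q v w =
     trace (matrix (\<lambda>u. curvature A D (extend A q u) (extend A q v) (extend A q w) q))"

text \<open>Trace of a \<open>(0,2)\<close>-tensor \<open>T\<close> with respect to \<open>g\<close>: the trace of the endomorphism \<open>L\<close> with
  \<open>g(L u, v) = T(u, v)\<close>.\<close>

definition metric_trace ::
  "(real ^ 'n \<Rightarrow> real ^ 'n \<Rightarrow> real) \<Rightarrow> (real ^ 'n::finite \<Rightarrow> real ^ 'n \<Rightarrow> real) \<Rightarrow> real" where
  "metric_trace g T = trace (matrix (\<lambda>u. THE w. \<forall>v. g w v = T u v))"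

definition scalar_curvature ::
  "('m, 'n::finite) chart set \<Rightarrow> ('m \<Rightarrow> real ^ 'n \<Rightarrow> real ^ 'n \<Rightarrow> real) \<Rightarrow>
   ('m, 'n) connection \<Rightarrow> 'm \<Rightarrow> real" where
  "scalar_curvature A g D q = metric_trace (g q) (ricci A D q)"


section \<open>The semi-symmetric metric connection\<close>

definition dual_form ::
  "('m \<Rightarrow> real ^ 'n::finite \<Rightarrow> real ^ 'n \<Rightarrow> real) \<Rightarrow> ('m \<Rightarrow> real ^ 'n) \<Rightarrow> 'm \<Rightarrow> real ^ 'n \<Rightarrow> real" where
  "dual_form g \<rho> q v = g q v (\<rho> q)"

definition semi_symmetric_connection ::
  "('m \<Rightarrow> real ^ 'n::finite \<Rightarrow> real ^ 'n \<Rightarrow> real) \<Rightarrow> ('m \<Rightarrow> real ^ 'n) \<Rightarrow>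
   ('m, 'n) connection \<Rightarrow> ('m, 'n) connection" where
  "semi_symmetric_connection g \<rho> D X Y q =
     D X Y q + dual_form g \<rho> q (Y q) *\<^sub>R X q - g q (X q) (Y q) *\<^sub>R \<rho> q"

text \<open>\<open>(\<nabla>\<^sub>X \<pi>)(Y) = X(\<pi>(Y)) - \<pi>(\<nabla>\<^sub>X Y)\<close>.\<close>

definition form_derivative ::
  "('m, 'n::finite) chart set \<Rightarrow> ('m, 'n) connection \<Rightarrow> ('m \<Rightarrow> real ^ 'n \<Rightarrow> real) \<Rightarrow>
   ('m \<Rightarrow> real ^ 'n) \<Rightarrow> ('m \<Rightarrow> real ^ 'n) \<Rightarrow> 'm \<Rightarrow> real" where
  "form_derivative A D \<omega> X Y q = vf_apply A X (\<lambda>x. \<omega> x (Y x)) q - \<omega> q (D X Y q)"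

definition P_tensor ::
  "('m, 'n::finite) chart set \<Rightarrow> ('m \<Rightarrow> real ^ 'n \<Rightarrow> real ^ 'n \<Rightarrow> real) \<Rightarrow> ('m \<Rightarrow> real ^ 'n) \<Rightarrow>
   ('m, 'n) connection \<Rightarrow> ('m \<Rightarrow> real ^ 'n) \<Rightarrow> ('m \<Rightarrow> real ^ 'n) \<Rightarrow> 'm \<Rightarrow> real" where
  "P_tensor A g \<rho> D X Y q =
     form_derivative A D (dual_form g \<rho>) X Y q
     - dual_form g \<rho> q (X q) * dual_form g \<rho> q (Y q)
     + 1/2 * dual_form g \<rho> q (\<rho> q) * g q (X q) (Y q)"

definition P_trace ::
  "('m, 'n::finite) chart set \<Rightarrow> ('m \<Rightarrow> real ^ 'n \<Rightarrow> real ^ 'n \<Rightarrow> real) \<Rightarrow> ('m \<Rightarrow> real ^ 'n) \<Rightarrow>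
   ('m, 'n) connection \<Rightarrow> 'm \<Rightarrow> real" where
  "P_trace A g \<rho> D q =
     metric_trace (g q) (\<lambda>u v. P_tensor A g \<rho> D (extend A q u) (extend A q v) q)"


section \<open>Solitons and torse-forming fields\<close>

text \<open>\<open>g(D\<^sub>X \<tau>, Y) + g(X, D\<^sub>Y \<tau>)\<close>.\<close>

definition lie_derivative_wrt ::
  "('m \<Rightarrow> real ^ 'n::finite \<Rightarrow> real ^ 'n \<Rightarrow> real) \<Rightarrow> ('m, 'n) connection \<Rightarrow>
   ('m \<Rightarrow> real ^ 'n) \<Rightarrow> ('m \<Rightarrow> real ^ 'n) \<Rightarrow> ('m \<Rightarrow> real ^ 'n) \<Rightarrow> 'm \<Rightarrow> real" where
  "lie_derivative_wrt g D \<tau> X Y q = g q (D X \<tau> q) (Y q) + g q (X q) (D Y \<tau> q)"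

definition conformal_yamabe_soliton ::
  "('m, 'n::finite) chart set \<Rightarrow> ('m, 'n) connection \<Rightarrow> ('m \<Rightarrow> real) \<Rightarrow>
   ('m \<Rightarrow> real ^ 'n \<Rightarrow> real ^ 'n \<Rightarrow> real) \<Rightarrow> ('m \<Rightarrow> real ^ 'n) \<Rightarrow> real \<Rightarrow> bool" where
  "conformal_yamabe_soliton A D p g \<tau> lam \<longleftrightarrow>
     vector_field A \<tau> \<and>
     (\<forall>X Y. vector_field A X \<longrightarrow> vector_field A Y \<longrightarrow>
        (\<forall>q. lie_derivative_wrt g D \<tau> X Y q
           + (2 * lam - 2 * scalar_curvature A g D q - (p q + 2 / real CARD('n)))
             * g q (X q) (Y q) = 0))"

definition expanding :: "real \<Rightarrow> bool" where "expanding lam \<longleftrightarrow> lam > 0"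
definition steady :: "real \<Rightarrow> bool" where "steady lam \<longleftrightarrow> lam = 0"
definition shrinking :: "real \<Rightarrow> bool" where "shrinking lam \<longleftrightarrow> lam < 0"

definition torse_forming ::
  "('m, 'n::finite) chart set \<Rightarrow> ('m, 'n) connection \<Rightarrow> ('m \<Rightarrow> real ^ 'n) \<Rightarrow>
   ('m \<Rightarrow> real) \<Rightarrow> ('m \<Rightarrow> real ^ 'n \<Rightarrow> real) \<Rightarrow> bool" where
  "torse_forming A D \<tau> \<phi> \<alpha> \<longleftrightarrow>
     vector_field A \<tau> \<and> (\<forall>q. \<tau> q \<noteq> 0) \<and> smooth_function A \<phi> \<and> one_form A \<alpha> \<and>
     (\<forall>X. vector_field A X \<longrightarrow> D X \<tau> = (\<lambda>q. \<phi> q *\<^sub>R X q + \<alpha> q (X q) *\<^sub>R \<tau> q))"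

end

theory Submission
  imports Defs
begin

text \<open>Expanding \<open>\<nabla>\<close>-bar gives
  \<open>R\<close>-bar\<open>(X,Y)Z = R(X,Y)Z - P(Y,Z)X + P(X,Z)Y - g(Y,Z)LX + g(X,Z)LY\<close> with \<open>g(LX,Y) = P(X,Y)\<close>;
  contracting twice yields \<open>r\<close>-bar \<open>= r - 2(n-1)a\<close>.  For a torse-forming \<open>\<tau>\<close> the soliton equation
  is an algebraic identity between bilinear forms on each tangent space, and its \<open>g\<close>-trace is the
  formula for \<open>\<lambda>\<close>.  The curvature and \<open>P\<close> are evaluated on arbitrary extensions of tangent
  vectors, so this needs that extensions exist (cutoff functions), that the expressions are
  tensorial, and that \<open>[X,Y]f = XYf - YXf\<close> determines a smooth field (symmetry of second
  derivatives).\<close>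

section \<open>Calculus of \<open>C\<^sup>k\<close> and smooth maps\<close>

text \<open>A \<open>connection\<close> acts on global fields only, and \<open>extend\<close> picks
  an arbitrary one, so nothing can be computed directly in local frames: local objects are first cut
  off to global ones, and pointwise values are recovered from linearity over smooth functions. The
  values of a field are components in a preferred chart that may jump from point to point; hence an
  expression is rewritten in one fixed chart before it is differentiated again. Two notions are
  definite descriptions. \<open>metric_trace\<close> is resolved by nondegeneracy of g, and traces
  are then sums over the coordinate basis; without orthonormal frames, the signature never enters.
  \<open>lie_bracket\<close> is resolved by an explicit coordinate formula. The torsion condition
  already equates it with nabla_X Y - nabla_Y X; that it also acts as a commutator is what cancels
  the second derivatives of f in R(X,Y)(fZ), and thereby makes Ric linear in its last
  argument.\<close>

lemma Ck_on_cong: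
  assumes "open S" "\<And>x. x \<in> S \<Longrightarrow> f x = g x"
  shows "Ck_on k f S \<longleftrightarrow> Ck_on k g S"
  using assms(2)
proof (induction k arbitrary: f g)
  case 0
  then show ?case by (simp cong: continuous_on_cong)
next
  case (Suc k)
  have imp: "Ck_on (Suc k) f' S \<Longrightarrow> Ck_on (Suc k) g' S" if eq: "\<And>x. x \<in> S \<Longrightarrow> f' x = g' x" for f' g' :: "'a \<Rightarrow> 'b"
  proof -
    assume f: "Ck_on (Suc k) f' S"
    \<comment> \<open>Openness of S makes equality on S an equality near x, which is all that a
      derivative sees.\<close>
    have der: "(g' has_derivative frechet_derivative f' (at x)) (at x)" if "x \<in> S" for x
    proof (rule has_derivative_transform_within_open[OF _ \<open>open S\<close> that eq])
      show "(f' has_derivative frechet_derivative f' (at x)) (at x)"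
        using f that by (simp add: frechet_derivative_works[symmetric])
    qed
    have "frechet_derivative g' (at x) = frechet_derivative f' (at x)" if "x \<in> S" for x
      using frechet_derivative_at[OF der[OF that]] by simp
    then have "Ck_on k (\<lambda>x. frechet_derivative g' (at x) v) S" for v
      using f Suc.IH[of "\<lambda>x. frechet_derivative g' (at x) v" "\<lambda>x. frechet_derivative f' (at x) v"]
      by simp
    then show "Ck_on (Suc k) g' S"
      using der by (auto simp: differentiable_def)
  qed
  show ?case
    using imp[of f g] imp[of g f] Suc.prems by metis
qed

lemma Ck_on_subset:
  assumes "Ck_on k f S" "T \<subseteq> S"
  shows "Ck_on k f T"
  using assms
  by (induction k arbitrary: f) (auto intro: continuous_on_subset)

text \<open>\<open>Ck_on (Suc k)\<close> constrains f only through its derivatives, so descending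
  one order takes an induction, with continuity of differentiable maps at the bottom.\<close>

lemma Ck_on_Suc_imp: "Ck_on (Suc k) f S \<Longrightarrow> Ck_on k f S"
proof (induction k arbitrary: f)
  case 0
  then show ?case
    by (auto intro!: continuous_at_imp_continuous_on differentiable_imp_continuous_within)
next
  case (Suc k)
  then show ?case by (metis Ck_on.simps(2))
qed

lemma Ck_on_Un:
  assumes "open S" "open T" "Ck_on k f S" "Ck_on k f T"
  shows "Ck_on k f (S \<union> T)"
  using assms(3,4)
proof (induction k arbitrary: f)
  case 0
  then show ?case using assms(1,2) by (simp add: continuous_on_open_Un)
next
  case (Suc k)
  then show ?case by auto
qed

lemma Ck_on_const: "Ck_on k (\<lambda>x. c) S"
  by (induction k arbitrary: c) auto

text \<open>The closure lemmas from here on share one scheme: find the pointwise derivative,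
  exchange it for an explicit formula by \<open>Ck_on_cong\<close>, and apply the induction
  hypothesis to the factors of that formula.\<close>

lemma Ck_on_linear_compose:
  assumes "open S" "bounded_linear L" "Ck_on k f S"
  shows "Ck_on k (\<lambda>x. L (f x)) S"
  using assms(3)
proof (induction k arbitrary: f)
  case 0
  then show ?case
    using assms(2) by (simp add: bounded_linear.continuous_on)
next
  case (Suc k)
  have der: "((\<lambda>x. L (f x)) has_derivative (\<lambda>v. L (frechet_derivative f (at x) v))) (at x)" if "x \<in> S" for x
    using Suc.prems that
    by (auto intro!: bounded_linear.has_derivative[OF assms(2)] simp: frechet_derivative_works[symmetric])
  have "frechet_derivative (\<lambda>x. L (f x)) (at x) = (\<lambda>v. L (frechet_derivative f (at x) v))" if "x \<in> S" for x
    using frechet_derivative_at[OF der[OF that]] by simp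
  then have "Ck_on k (\<lambda>x. frechet_derivative (\<lambda>x. L (f x)) (at x) v) S" for v
    using Suc.prems Suc.IH[of "\<lambda>x. frechet_derivative f (at x) v"]
    by (subst Ck_on_cong[OF \<open>open S\<close>]) auto
  then show ?case using der by (auto simp: differentiable_def)
qed

lemma Ck_on_add:
  assumes "open S" "Ck_on k f S" "Ck_on k g S"
  shows "Ck_on k (\<lambda>x. f x + g x) S"
  using assms(2,3)
proof (induction k arbitrary: f g)
  case 0
  then show ?case by (simp add: continuous_on_add)
next
  case (Suc k)
  have der: "((\<lambda>x. f x + g x) has_derivative
      (\<lambda>v. frechet_derivative f (at x) v + frechet_derivative g (at x) v)) (at x)" if "x \<in> S" for x
    using Suc.prems that by (auto intro!: has_derivative_add simp: frechet_derivative_works[symmetric])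
  have "frechet_derivative (\<lambda>x. f x + g x) (at x) =
      (\<lambda>v. frechet_derivative f (at x) v + frechet_derivative g (at x) v)" if "x \<in> S" for x
    using frechet_derivative_at[OF der[OF that]] by simp
  then have "Ck_on k (\<lambda>x. frechet_derivative (\<lambda>x. f x + g x) (at x) v) S" for v
    using Suc.prems Suc.IH[of "\<lambda>x. frechet_derivative f (at x) v" "\<lambda>x. frechet_derivative g (at x) v"]
    by (subst Ck_on_cong[OF \<open>open S\<close>]) auto
  then show ?case using der by (auto simp: differentiable_def)
qed

text \<open>The Leibniz rule mixes f with derivatives of g, so the induction needs f and g
  themselves to be of class \<open>k\<close>. One statement serves products, scalar multiples and
  inner products.\<close>

lemma Ck_on_bilinear:
  assumes "open S" "bounded_bilinear B" "Ck_on k f S" "Ck_on k g S"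
  shows "Ck_on k (\<lambda>x. B (f x) (g x)) S"
  using assms(3,4)
proof (induction k arbitrary: f g)
  case 0
  then show ?case using assms(2) by (simp add: bounded_bilinear.continuous_on)
next
  case (Suc k)
  have der: "((\<lambda>x. B (f x) (g x)) has_derivative
      (\<lambda>v. B (f x) (frechet_derivative g (at x) v) + B (frechet_derivative f (at x) v) (g x))) (at x)"
    if "x \<in> S" for x
    using Suc.prems that
    by (auto intro!: bounded_bilinear.FDERIV[OF assms(2)] simp: frechet_derivative_works[symmetric])
  have "frechet_derivative (\<lambda>x. B (f x) (g x)) (at x) =
      (\<lambda>v. B (f x) (frechet_derivative g (at x) v) + B (frechet_derivative f (at x) v) (g x))"
    if "x \<in> S" for x
    using frechet_derivative_at[OF der[OF that]] by simp
  moreover have "Ck_on k f S" "Ck_on k g S"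
    using Suc.prems by (auto intro: Ck_on_Suc_imp simp del: Ck_on.simps)
  ultimately have "Ck_on k (\<lambda>x. frechet_derivative (\<lambda>x. B (f x) (g x)) (at x) v) S" for v
    using Suc.prems by (subst Ck_on_cong[OF \<open>open S\<close>]) (auto intro!: Ck_on_add Suc.IH \<open>open S\<close>)
  then show ?case using der by (auto simp: differentiable_def)
qed

lemma Ck_on_sum:
  assumes "open S" "\<And>i. i \<in> I \<Longrightarrow> Ck_on k (f i) S"
  shows "Ck_on k (\<lambda>x. \<Sum>i\<in>I. f i x) S"
  using assms(2) by (induction I rule: infinite_finite_induct) (auto intro!: Ck_on_const Ck_on_add assms(1))

text \<open>Reduces a derivative in a direction that varies with the point to finitely many fixed
  directions, the only ones that \<open>Ck_on\<close> controls. This is where finite dimension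
  enters the calculus.\<close>

lemma linear_sum_Basis:
  fixes L :: "'a::euclidean_space \<Rightarrow> 'b::real_vector"
  assumes "linear L"
  shows "L w = (\<Sum>b\<in>Basis. (w \<bullet> b) *\<^sub>R L b)"
proof -
  have "L w = L (\<Sum>b\<in>Basis. (w \<bullet> b) *\<^sub>R b)" by (simp add: euclidean_representation)
  then show ?thesis using assms by (simp add: linear_sum linear_cmul)
qed

text \<open>In the chain rule the direction \<open>frechet_derivative f (at x) v\<close> moves with
  x. Expanded in \<open>Basis\<close> it leaves products whose second factor is a derivative of g
  composed with the same f, hence the induction over varying g.\<close>

lemma Ck_on_compose:
  fixes f :: "'a::real_normed_vector \<Rightarrow> 'b::euclidean_space" and g :: "'b \<Rightarrow> 'c::real_normed_vector"
  assumes "open S" "open T" "f ` S \<subseteq> T" "Ck_on k f S" "Ck_on k g T"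
  shows "Ck_on k (\<lambda>x. g (f x)) S"
  using assms(4,5)
proof (induction k arbitrary: g)
  case 0
  then show ?case
    using continuous_on_compose2[of T g S f] assms(3) by simp
next
  case (Suc k)
  have g: "g differentiable (at (f x))" if "x \<in> S" for x using Suc.prems that assms(3) by auto
  have der: "((\<lambda>x. g (f x)) has_derivative
      (\<lambda>v. frechet_derivative g (at (f x)) (frechet_derivative f (at x) v))) (at x)"
    if "x \<in> S" for x
    by (rule has_derivative_compose)
      (use Suc.prems that g[OF that] in \<open>simp_all add: frechet_derivative_works[symmetric]\<close>)
  have *: "frechet_derivative (\<lambda>x. g (f x)) (at x) v =
      (\<Sum>b\<in>Basis. (frechet_derivative f (at x) v \<bullet> b) *\<^sub>R frechet_derivative g (at (f x)) b)"
    if "x \<in> S" for x v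
    using linear_sum_Basis[OF linear_frechet_derivative[OF g[OF that]], of "frechet_derivative f (at x) v"]
    by (simp add: frechet_derivative_at[OF der[OF that], symmetric])
  have fk: "Ck_on k f S" using Suc.prems(1) by (rule Ck_on_Suc_imp)
  have "Ck_on k (\<lambda>x. (frechet_derivative f (at x) v \<bullet> b) *\<^sub>R frechet_derivative g (at (f x)) b) S" for v b
  proof (rule Ck_on_bilinear[OF \<open>open S\<close> bounded_bilinear_scaleR])
    show "Ck_on k (\<lambda>x. frechet_derivative f (at x) v \<bullet> b) S"
      by (rule Ck_on_linear_compose[OF \<open>open S\<close> bounded_linear_inner_left]) (use Suc.prems in auto)
    show "Ck_on k (\<lambda>x. frechet_derivative g (at (f x)) b) S"
      by (rule Suc.IH[OF fk]) (use Suc.prems in auto)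
  qed
  then have "Ck_on k (\<lambda>x. frechet_derivative (\<lambda>x. g (f x)) (at x) v) S" for v
    by (subst Ck_on_cong[OF \<open>open S\<close> *]) (auto intro!: Ck_on_sum \<open>open S\<close>)
  then show ?case using der by (auto simp: differentiable_def)
qed

lemma smooth_on_cong:
  "open S \<Longrightarrow> (\<And>x. x \<in> S \<Longrightarrow> f x = g x) \<Longrightarrow> smooth_on S f \<longleftrightarrow> smooth_on S g"
  unfolding smooth_on_def using Ck_on_cong by blast

lemma smooth_on_transform:
  "open S \<Longrightarrow> smooth_on S g \<Longrightarrow> (\<And>x. x \<in> S \<Longrightarrow> f x = g x) \<Longrightarrow> smooth_on S f"
  using smooth_on_cong by metis

lemma smooth_on_subset: "smooth_on S f \<Longrightarrow> T \<subseteq> S \<Longrightarrow> smooth_on T f"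
  unfolding smooth_on_def using Ck_on_subset by blast

lemma smooth_on_Un:
  "open S \<Longrightarrow> open T \<Longrightarrow> smooth_on S f \<Longrightarrow> smooth_on T f \<Longrightarrow> smooth_on (S \<union> T) f"
  by (auto simp: smooth_on_def intro!: Ck_on_Un)

lemma smooth_on_const: "smooth_on S (\<lambda>x. c)"
  unfolding smooth_on_def by (simp add: Ck_on_const)

lemma smooth_on_linear_compose:
  "open S \<Longrightarrow> bounded_linear L \<Longrightarrow> smooth_on S f \<Longrightarrow> smooth_on S (\<lambda>x. L (f x))"
  unfolding smooth_on_def using Ck_on_linear_compose[of S L _ f] by simp

lemma smooth_on_add:
  "open S \<Longrightarrow> smooth_on S f \<Longrightarrow> smooth_on S g \<Longrightarrow> smooth_on S (\<lambda>x. f x + g x)"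
  unfolding smooth_on_def using Ck_on_add[of S _ f g] by simp

lemma smooth_on_bilinear:
  "open S \<Longrightarrow> bounded_bilinear B \<Longrightarrow> smooth_on S f \<Longrightarrow> smooth_on S g \<Longrightarrow>
    smooth_on S (\<lambda>x. B (f x) (g x))"
  unfolding smooth_on_def using Ck_on_bilinear[of S B _ f g] by simp

lemmas smooth_on_scaleR = smooth_on_bilinear[OF _ bounded_bilinear_scaleR]
lemmas smooth_on_mult = smooth_on_bilinear[OF _ bounded_bilinear_mult]

lemma smooth_on_diff:
  assumes "open S" "smooth_on S f" "smooth_on S g"
  shows "smooth_on S (\<lambda>x. f x - g x)"
  using smooth_on_add[OF assms(1,2) smooth_on_linear_compose[OF assms(1) bounded_linear_minus[OF bounded_linear_ident] assms(3)]]
  by simp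

lemma smooth_on_sum:
  "open S \<Longrightarrow> (\<And>i. i \<in> I \<Longrightarrow> smooth_on S (f i)) \<Longrightarrow> smooth_on S (\<lambda>x. \<Sum>i\<in>I. f i x)"
  unfolding smooth_on_def using Ck_on_sum[of S I _ f] by simp

lemma smooth_on_ident: "smooth_on S (\<lambda>x. x)"
proof -
  have "Ck_on k (\<lambda>x. x) S" for k
    by (cases k) (auto simp: Ck_on_const)
  then show ?thesis by (simp add: smooth_on_def)
qed

lemma smooth_on_compose:
  fixes f :: "'a::real_normed_vector \<Rightarrow> 'b::euclidean_space" and g :: "'b \<Rightarrow> 'c::real_normed_vector"
  shows "open S \<Longrightarrow> open T \<Longrightarrow> f ` S \<subseteq> T \<Longrightarrow> smooth_on S f \<Longrightarrow> smooth_on T g \<Longrightarrow>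
    smooth_on S (\<lambda>x. g (f x))"
  unfolding smooth_on_def using Ck_on_compose[of S T f _ g] by simp

lemma smooth_on_imp_differentiable: "smooth_on S f \<Longrightarrow> x \<in> S \<Longrightarrow> f differentiable (at x)"
  unfolding smooth_on_def by (metis Ck_on.simps(2))

lemma smooth_on_imp_has_derivative:
  "smooth_on S f \<Longrightarrow> x \<in> S \<Longrightarrow> (f has_derivative frechet_derivative f (at x)) (at x)"
  using smooth_on_imp_differentiable frechet_derivative_works by blast

lemma smooth_on_frechet_derivative:
  "smooth_on S f \<Longrightarrow> smooth_on S (\<lambda>x. frechet_derivative f (at x) v)"
  unfolding smooth_on_def by (metis Ck_on.simps(2))

lemma smooth_on_frechet_derivative_field:
  fixes f :: "'a::euclidean_space \<Rightarrow> 'b::real_normed_vector"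
  assumes "open S" "smooth_on S f" "smooth_on S W"
  shows "smooth_on S (\<lambda>x. frechet_derivative f (at x) (W x))"
proof -
  have "smooth_on S (\<lambda>x. \<Sum>b\<in>Basis. (W x \<bullet> b) *\<^sub>R frechet_derivative f (at x) b)"
    by (intro smooth_on_sum smooth_on_scaleR assms smooth_on_frechet_derivative
        smooth_on_linear_compose[OF _ bounded_linear_inner_left])
  moreover have "frechet_derivative f (at x) (W x) = (\<Sum>b\<in>Basis. (W x \<bullet> b) *\<^sub>R frechet_derivative f (at x) b)"
    if "x \<in> S" for x
    by (rule linear_sum_Basis[OF linear_frechet_derivative])
       (use assms that in \<open>auto intro: smooth_on_imp_differentiable\<close>)
  ultimately show ?thesis by (rule smooth_on_transform[OF assms(1)])
qed

lemma frechet_derivative_chain: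
  assumes "f differentiable (at x)" "g differentiable (at (f x))"
  shows "frechet_derivative (\<lambda>x. g (f x)) (at x) v = frechet_derivative g (at (f x)) (frechet_derivative f (at x) v)"
  using frechet_derivative_compose[OF assms] by (simp add: o_def fun_eq_iff)

text \<open>Both iterated derivatives are limits of the same second difference quotient.\<close>

lemma second_difference:
  fixes f :: "'a::real_normed_vector \<Rightarrow> real"
  assumes S: "\<And>s t. 0 \<le> s \<Longrightarrow> s \<le> h \<Longrightarrow> 0 \<le> t \<Longrightarrow> t \<le> h \<Longrightarrow> x + s *\<^sub>R u + t *\<^sub>R v \<in> S"
    and f: "smooth_on S f" and "h > 0"
  obtains s t where "0 < s" "s < h" "0 < t" "t < h"
    "f (x + h *\<^sub>R u + h *\<^sub>R v) - f (x + h *\<^sub>R u) - f (x + h *\<^sub>R v) + f x =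
     h\<^sup>2 * frechet_derivative (\<lambda>y. frechet_derivative f (at y) u) (at (x + s *\<^sub>R u + t *\<^sub>R v)) v"
proof -
  define fu where "fu \<equiv> \<lambda>y. frechet_derivative f (at y) u"
  have S0: "x + s *\<^sub>R u \<in> S" if "0 \<le> s" "s \<le> h" for s
    using S[of s 0] that \<open>h > 0\<close> by simp
  have line: "((\<lambda>s. k (y + s *\<^sub>R w)) has_real_derivative frechet_derivative k (at (y + s *\<^sub>R w)) w) (at s)"
    if k: "smooth_on S k" "y + s *\<^sub>R w \<in> S" for k :: "'a \<Rightarrow> real" and y w s
  proof -
    have "((\<lambda>s. k (y + s *\<^sub>R w)) has_derivative (\<lambda>r. frechet_derivative k (at (y + s *\<^sub>R w)) (0 + r *\<^sub>R w))) (at s)"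
      by (rule has_derivative_compose[where f = "\<lambda>s. y + s *\<^sub>R w" and f' = "\<lambda>r. 0 + r *\<^sub>R w"])
         (use smooth_on_imp_has_derivative[OF that] in \<open>auto intro!: derivative_eq_intros\<close>)
    moreover have "linear (frechet_derivative k (at (y + s *\<^sub>R w)))"
      using smooth_on_imp_differentiable[OF that] linear_frechet_derivative by blast
    ultimately show ?thesis
      by (simp add: has_field_derivative_def linear_cmul mult.commute[of _ "frechet_derivative _ _ _"])
  qed
  \<comment> \<open>\<open>G h - G 0\<close> is the second difference. The mean value theorem in s
    yields one factor h and a derivative along u; applied again in t it yields the other factor and
    a derivative along v.\<close>
  define G where "G \<equiv> \<lambda>s. f ((x + h *\<^sub>R v) + s *\<^sub>R u) - f (x + s *\<^sub>R u)"
  have "(G has_real_derivative fu ((x + h *\<^sub>R v) + s *\<^sub>R u) - fu (x + s *\<^sub>R u)) (at s)"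
    if "0 \<le> s" "s \<le> h" for s
    unfolding G_def fu_def
    by (intro DERIV_diff line f S0 that) (use S[of s h] that in \<open>simp add: ac_simps\<close>)
  from MVT2[OF \<open>h > 0\<close> this] obtain s where s: "0 < s" "s < h"
    and G: "G h - G 0 = (h - 0) * (fu ((x + h *\<^sub>R v) + s *\<^sub>R u) - fu (x + s *\<^sub>R u))" by metis
  have "smooth_on S fu" unfolding fu_def by (rule smooth_on_frechet_derivative[OF f])
  then have "((\<lambda>t. fu ((x + s *\<^sub>R u) + t *\<^sub>R v)) has_real_derivative
      frechet_derivative fu (at ((x + s *\<^sub>R u) + t *\<^sub>R v)) v) (at t)" if "0 \<le> t" "t \<le> h" for t
    by (intro line) (use S[of s t] s that in auto)
  from MVT2[OF \<open>h > 0\<close> this] obtain t where t: "0 < t" "t < h"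
    and fu: "fu ((x + s *\<^sub>R u) + h *\<^sub>R v) - fu ((x + s *\<^sub>R u) + 0 *\<^sub>R v) =
      (h - 0) * frechet_derivative fu (at ((x + s *\<^sub>R u) + t *\<^sub>R v)) v" by metis
  show ?thesis
  proof (rule that[OF s t])
    have "f (x + h *\<^sub>R u + h *\<^sub>R v) - f (x + h *\<^sub>R u) - f (x + h *\<^sub>R v) + f x = G h - G 0"
      by (simp add: G_def ac_simps)
    also have "\<dots> = h * (fu ((x + s *\<^sub>R u) + h *\<^sub>R v) - fu ((x + s *\<^sub>R u) + 0 *\<^sub>R v))"
      using G by (simp add: ac_simps)
    also have "\<dots> = h\<^sup>2 * frechet_derivative fu (at (x + s *\<^sub>R u + t *\<^sub>R v)) v"
      using fu by (simp add: power2_eq_square)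
    finally show "f (x + h *\<^sub>R u + h *\<^sub>R v) - f (x + h *\<^sub>R u) - f (x + h *\<^sub>R v) + f x =
     h\<^sup>2 * frechet_derivative (\<lambda>y. frechet_derivative f (at y) u) (at (x + s *\<^sub>R u + t *\<^sub>R v)) v"
      unfolding fu_def .
  qed
qed

lemma smooth_on_continuous_on: "smooth_on S f \<Longrightarrow> continuous_on S f"
  unfolding smooth_on_def by (metis Ck_on.simps(1))

lemma second_derivative_symmetric_real:
  fixes f :: "'a::real_normed_vector \<Rightarrow> real"
  assumes "open S" "x \<in> S" "smooth_on S f"
  shows "frechet_derivative (\<lambda>y. frechet_derivative f (at y) u) (at x) v =
         frechet_derivative (\<lambda>y. frechet_derivative f (at y) v) (at x) u"
proof -
  define A where "A \<equiv> \<lambda>u v y. frechet_derivative (\<lambda>y. frechet_derivative f (at y) u) (at y) v"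
  have cont: "isCont (A u v) x" for u v
    using smooth_on_continuous_on[OF smooth_on_frechet_derivative[OF smooth_on_frechet_derivative[OF assms(3)]]]
      assms(1,2) unfolding A_def by (simp add: continuous_on_eq_continuous_at)
  have "\<bar>A u v x - A v u x\<bar> \<le> e" if "e > 0" for e
  proof -
    have "\<exists>d>0. \<forall>y. dist y x < d \<longrightarrow> \<bar>A u v y - A u v x\<bar> < e / 2" for u v
      using cont[of u v] \<open>e > 0\<close> unfolding continuous_at_eps_delta dist_real_def
      by (metis half_gt_zero_iff)
    then obtain d1 d2 where d: "d1 > 0" "d2 > 0"
      "\<And>y. dist y x < d1 \<Longrightarrow> \<bar>A u v y - A u v x\<bar> < e / 2"
      "\<And>y. dist y x < d2 \<Longrightarrow> \<bar>A v u y - A v u x\<bar> < e / 2" by metis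
    obtain d3 where d3: "d3 > 0" "ball x d3 \<subseteq> S"
      using assms(1,2) open_contains_ball by blast
    define \<delta> where "\<delta> = min d1 (min d2 d3)"
    \<comment> \<open>Keeps the parallelogram spanned by h u and h v inside the ball of radius
      \<delta>; the summand 1 excludes division by zero when u and v vanish.\<close>
    define h where "h = \<delta> / (2 * (norm u + norm v + 1))"
    have pos: "\<delta> > 0" "h > 0" using d d3
      by (auto simp: \<delta>_def h_def intro!: divide_pos_pos add_nonneg_pos)
    have near: "dist (x + s *\<^sub>R u + t *\<^sub>R v) x < \<delta>" if "0 \<le> s" "s \<le> h" "0 \<le> t" "t \<le> h" for s t
    proof -
      have "dist (x + s *\<^sub>R u + t *\<^sub>R v) x = norm (s *\<^sub>R u + t *\<^sub>R v)"
        by (simp add: dist_norm)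
      also have "\<dots> \<le> s * norm u + t * norm v"
        using norm_triangle_ineq[of "s *\<^sub>R u" "t *\<^sub>R v"] that by simp
      also have "\<dots> \<le> h * norm u + h * norm v"
        using that by (intro add_mono mult_right_mono) auto
      also have "\<dots> < h * (2 * (norm u + norm v + 1))"
        unfolding distrib_left[symmetric]
      proof (rule mult_strict_left_mono[OF _ pos(2)])
        have "c < 2 * (c + 1)" if "0 \<le> c" for c :: real using that by simp
        then show "norm u + norm v < 2 * (norm u + norm v + 1)" by (meson add_nonneg_nonneg norm_ge_zero)
      qed
      also have "\<dots> = \<delta>"
      proof -
        have "0 < 2 * (norm u + norm v + 1)" by (intro mult_pos_pos add_nonneg_pos) auto
        then show ?thesis by (simp add: h_def)
      qed
      finally show ?thesis .
    qed
    have inS: "x + s *\<^sub>R u + t *\<^sub>R v \<in> S" if "0 \<le> s" "s \<le> h" "0 \<le> t" "t \<le> h" for s t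
      using near[OF that] d3 by (auto simp: \<delta>_def dist_commute subset_iff)
    have inS': "x + s *\<^sub>R v + t *\<^sub>R u \<in> S" if "0 \<le> s" "s \<le> h" "0 \<le> t" "t \<le> h" for s t
      using inS[OF that(3,4,1,2)] by (simp add: ac_simps)
    \<comment> \<open>Exchanging u and v leaves the second difference unchanged, so the two mixed
      derivatives agree at two points near x, possibly different ones; continuity carries this to
      x.\<close>
    obtain s t where st: "0 < s" "s < h" "0 < t" "t < h"
      "f (x + h *\<^sub>R u + h *\<^sub>R v) - f (x + h *\<^sub>R u) - f (x + h *\<^sub>R v) + f x =
        h\<^sup>2 * A u v (x + s *\<^sub>R u + t *\<^sub>R v)"
      unfolding A_def by (rule second_difference[OF inS assms(3) pos(2)])
    obtain s' t' where st': "0 < s'" "s' < h" "0 < t'" "t' < h"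
      "f (x + h *\<^sub>R v + h *\<^sub>R u) - f (x + h *\<^sub>R v) - f (x + h *\<^sub>R u) + f x =
        h\<^sup>2 * A v u (x + s' *\<^sub>R v + t' *\<^sub>R u)"
      unfolding A_def by (rule second_difference[OF inS' assms(3) pos(2)])
    have "h\<^sup>2 * A u v (x + s *\<^sub>R u + t *\<^sub>R v) = h\<^sup>2 * A v u (x + t' *\<^sub>R u + s' *\<^sub>R v)"
      using st(5) st'(5) by (simp add: algebra_simps)
    then have "A u v (x + s *\<^sub>R u + t *\<^sub>R v) = A v u (x + t' *\<^sub>R u + s' *\<^sub>R v)"
      using pos(2) by simp
    moreover have "\<bar>A u v (x + s *\<^sub>R u + t *\<^sub>R v) - A u v x\<bar> < e / 2"
      using near[of s t] st by (intro d(3)) (simp add: \<delta>_def)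
    moreover have "\<bar>A v u (x + t' *\<^sub>R u + s' *\<^sub>R v) - A v u x\<bar> < e / 2"
      using near[of t' s'] st' by (intro d(4)) (simp add: \<delta>_def)
    ultimately show ?thesis by linarith
  qed
  then have "\<bar>A u v x - A v u x\<bar> \<le> 0" by (rule field_le_epsilon) simp
  then show ?thesis by (simp add: A_def)
qed

text \<open>The mean value theorem has no equality form for vector values, so the identity is tested
  on each coordinate, which commutes with both derivatives.\<close>

lemma second_derivative_symmetric:
  fixes f :: "'a::real_normed_vector \<Rightarrow> 'b::euclidean_space"
  assumes "open S" "x \<in> S" "smooth_on S f"
  shows "frechet_derivative (\<lambda>y. frechet_derivative f (at y) u) (at x) v =
         frechet_derivative (\<lambda>y. frechet_derivative f (at y) v) (at x) u"
proof (rule euclidean_eqI)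
  fix b :: 'b
  assume "b \<in> Basis"
  have comp: "frechet_derivative k (at y) w \<bullet> b = frechet_derivative (\<lambda>y. k y \<bullet> b) (at y) w"
    if "smooth_on S k" "y \<in> S" for k :: "'a \<Rightarrow> 'b" and y w
    using frechet_derivative_at[OF bounded_linear.has_derivative[OF bounded_linear_inner_left
          smooth_on_imp_has_derivative[OF that]], of b] by metis
  have *: "frechet_derivative (\<lambda>y. frechet_derivative f (at y) u) (at x) v \<bullet> b =
      frechet_derivative (\<lambda>y. frechet_derivative (\<lambda>y. f y \<bullet> b) (at y) u) (at x) v" for u v
  proof -
    have "frechet_derivative (\<lambda>y. frechet_derivative f (at y) u) (at x) v \<bullet> b =
        frechet_derivative (\<lambda>y. frechet_derivative f (at y) u \<bullet> b) (at x) v"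
      by (rule comp[OF smooth_on_frechet_derivative[OF assms(3)] assms(2)])
    also have "frechet_derivative (\<lambda>y. frechet_derivative f (at y) u \<bullet> b) (at x) =
        frechet_derivative (\<lambda>y. frechet_derivative (\<lambda>y. f y \<bullet> b) (at y) u) (at x)"
    proof (rule frechet_derivative_transform_within_open[OF _ assms(1,2)])
      show "(\<lambda>y. frechet_derivative f (at y) u \<bullet> b) differentiable at x"
        by (rule smooth_on_imp_differentiable[OF smooth_on_linear_compose[OF assms(1) bounded_linear_inner_left
              smooth_on_frechet_derivative[OF assms(3)]] assms(2)])
    qed (use comp[OF assms(3)] in auto)
    finally show ?thesis .
  qed
  show "frechet_derivative (\<lambda>y. frechet_derivative f (at y) u) (at x) v \<bullet> b =
         frechet_derivative (\<lambda>y. frechet_derivative f (at y) v) (at x) u \<bullet> b"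
    unfolding *
    by (rule second_derivative_symmetric_real[OF assms(1,2)
          smooth_on_linear_compose[OF assms(1) bounded_linear_inner_left assms(3)]])
qed

text \<open>The family \<open>t\<^sup>-\<^sup>k exp (-1/t)\<close> is closed under differentiation up to linear combinations, which
  makes smoothness an induction over all \<open>k\<close> at once.\<close>

definition flat_fun :: "nat \<Rightarrow> real \<Rightarrow> real" where
  "flat_fun k t = (if t > 0 then exp (- (1 / t)) / t ^ k else 0)"

text \<open>On the right, t = 1/s turns the claim into the decay of s^k / exp s at infinity; on the
  left the function is zero.\<close>

lemma flat_fun_tendsto_0: "(flat_fun k \<longlongrightarrow> 0) (at 0)"
proof -
  have "((\<lambda>t::real. inverse t ^ k / exp (inverse t)) \<longlongrightarrow> 0) (at_right 0)"
    using tendsto_power_div_exp_0 filterlim_inverse_at_top_right by (rule filterlim_compose)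
  moreover have "\<forall>\<^sub>F t in at_right 0. inverse t ^ k / exp (inverse t) = flat_fun k t"
    by (auto simp: flat_fun_def eventually_at_filter exp_minus field_simps power_inverse
        intro!: always_eventually)
  ultimately have "(flat_fun k \<longlongrightarrow> 0) (at_right 0)" by (rule Lim_transform_eventually)
  moreover have "(flat_fun k \<longlongrightarrow> 0) (at_left 0)"
    by (rule Lim_transform_eventually[OF tendsto_const])
       (auto simp: flat_fun_def eventually_at_filter intro!: always_eventually)
  ultimately show ?thesis by (simp add: filterlim_at_split)
qed

text \<open>At 0 the difference quotient of \<open>flat_fun k\<close> is
  \<open>flat_fun (Suc k)\<close>, so differentiability at this critical point is the preceding
  limit for the next exponent.\<close>

lemma flat_fun_has_derivative:
  "(flat_fun k has_real_derivative flat_fun (k + 2) t - real k * flat_fun (k + 1) t) (at t)"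
proof -
  consider "t > 0" | "t < 0" | "t = 0" by linarith
  then show ?thesis
  proof cases
    case 1
    have "((\<lambda>t. exp (- (1 / t)) / t ^ k) has_real_derivative flat_fun (k + 2) t - real k * flat_fun (k + 1) t) (at t)"
    proof (cases "k = 0")
      case True
      then show ?thesis
        using 1 by (auto intro!: derivative_eq_intros simp: flat_fun_def power2_eq_square)
    next
      case False
      \<comment> \<open>Since k is not 0, the truncated exponent \<open>k - Suc 0\<close> from the
        power rule is a true predecessor.\<close>
      then have "t ^ k = t * t ^ (k - Suc 0)" by (cases k) auto
      then have "exp (- (1 / t)) * (1 / t\<^sup>2) / t ^ k - exp (- (1 / t)) * (real k * t ^ (k - Suc 0)) / (t ^ k * t ^ k)
        = flat_fun (k + 2) t - real k * flat_fun (k + 1) t"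
        using 1 by (simp add: flat_fun_def field_simps power2_eq_square)
      then show ?thesis
        using 1 by (auto intro!: derivative_eq_intros simp: power2_eq_square diff_divide_distrib)
    qed
    then show ?thesis
      by (rule has_field_derivative_transform_within_open[of _ _ _ "{0<..}"]) (use 1 in \<open>auto simp: flat_fun_def\<close>)
  next
    case 2
    have "((\<lambda>t. 0) has_real_derivative flat_fun (k + 2) t - real k * flat_fun (k + 1) t) (at t)"
      using 2 by (simp add: flat_fun_def)
    then show ?thesis
      by (rule has_field_derivative_transform_within_open[of _ _ _ "{..<0}"]) (use 2 in \<open>auto simp: flat_fun_def\<close>)
  next
    case 3
    have "(\<lambda>s. (flat_fun k (0 + s) - flat_fun k 0) / s) = flat_fun (Suc k)"
      by (auto simp: flat_fun_def fun_eq_iff)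
    then show ?thesis
      using flat_fun_tendsto_0[of "Suc k"] 3 by (simp add: DERIV_def flat_fun_def)
  qed
qed

lemma smooth_on_flat_fun: "smooth_on UNIV (flat_fun k)"
proof -
  have "Ck_on m (flat_fun k) UNIV" for m k
  proof (induction m arbitrary: k)
    case 0
    then show ?case
      using DERIV_isCont[OF flat_fun_has_derivative] by (auto simp: continuous_on_eq_continuous_at)
  next
    case (Suc m)
    have der: "(flat_fun k has_derivative (\<lambda>v. (flat_fun (k + 2) t - real k * flat_fun (k + 1) t) * v)) (at t)" for t
      using flat_fun_has_derivative by (simp add: has_field_derivative_def)
    have "frechet_derivative (flat_fun k) (at t) v = flat_fun (k + 2) t * v + flat_fun (k + 1) t * (- real k * v)" for t v
      by (simp add: frechet_derivative_at[OF der, symmetric] algebra_simps)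
    moreover have "Ck_on m (\<lambda>t. flat_fun (k + 2) t * v + flat_fun (k + 1) t * (- real k * v)) UNIV" for v
      by (intro Ck_on_add Ck_on_linear_compose[OF _ bounded_linear_mult_left] Suc.IH open_UNIV)
    ultimately show ?case using differentiableI[OF der] by simp
  qed
  then show ?thesis by (simp add: smooth_on_def)
qed

text \<open>Inside the ball, h is exp (-1/(r^2 - |x - x0|^2)) divided by its value at x0. The
  squared distance is smooth even at x0, and outside the ball the argument of
  \<open>flat_fun\<close> is negative.\<close>

lemma bump_function:
  fixes x0 :: "'a::euclidean_space"
  assumes "r > 0"
  obtains h :: "'a \<Rightarrow> real" where "smooth_on UNIV h" "h x0 = 1" "\<And>x. x \<notin> cball x0 r \<Longrightarrow> h x = 0"
proof
  define h where "h \<equiv> \<lambda>x. flat_fun 0 (r\<^sup>2 - (x - x0) \<bullet> (x - x0)) * (1 / flat_fun 0 (r\<^sup>2))"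
  have "smooth_on UNIV (\<lambda>x. r\<^sup>2 - (x - x0) \<bullet> (x - x0))"
    by (intro smooth_on_diff smooth_on_const smooth_on_ident smooth_on_bilinear[OF _ bounded_bilinear_inner]) auto
  from smooth_on_compose[OF open_UNIV open_UNIV subset_UNIV this smooth_on_flat_fun]
  show "smooth_on UNIV h"
    unfolding h_def by (rule smooth_on_linear_compose[OF open_UNIV bounded_linear_mult_left])
  show "h x0 = 1" using assms by (simp add: h_def flat_fun_def)
  show "h x = 0" if "x \<notin> cball x0 r" for x
  proof -
    have "r < norm (x - x0)" using that by (simp add: dist_norm norm_minus_commute)
    then have "r\<^sup>2 < (x - x0) \<bullet> (x - x0)"
      using assms by (simp add: power2_norm_eq_inner[symmetric] power_strict_mono)
    then show ?thesis by (simp add: h_def flat_fun_def)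
  qed
qed

section \<open>Smooth manifolds\<close>

text \<open>With \<open>V y\<close> expanded in the basis the expression is a finite sum of
  products; after Leibniz the terms regroup into one with V frozen at x and one with V
  differentiated.\<close>

lemma has_derivative_frechet_derivative_field:
  fixes \<psi> :: "'a::euclidean_space \<Rightarrow> 'b::real_normed_vector"
  assumes "open S" "x \<in> S" "smooth_on S \<psi>" "smooth_on S V"
  shows "((\<lambda>y. frechet_derivative \<psi> (at y) (V y)) has_derivative
     (\<lambda>w. frechet_derivative (\<lambda>y. frechet_derivative \<psi> (at y) (V x)) (at x) w
        + frechet_derivative \<psi> (at x) (frechet_derivative V (at x) w))) (at x)"
proof -
  let ?D = "\<lambda>b y. frechet_derivative \<psi> (at y) b"
  have lin: "linear (frechet_derivative \<psi> (at y))" if "y \<in> S" for y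
    using assms(3) that smooth_on_imp_differentiable linear_frechet_derivative by blast
  have expand: "(\<Sum>b\<in>Basis. (v \<bullet> b) *\<^sub>R ?D b y) = frechet_derivative \<psi> (at y) v" if "y \<in> S" for y v
    by (rule linear_sum_Basis[OF lin[OF that], symmetric])
  have D: "(?D b has_derivative frechet_derivative (?D b) (at x)) (at x)" for b
    by (rule smooth_on_imp_has_derivative[OF smooth_on_frechet_derivative[OF assms(3)] assms(2)])
  have V: "(V has_derivative frechet_derivative V (at x)) (at x)"
    by (rule smooth_on_imp_has_derivative[OF assms(4,2)])
  have "((\<lambda>y. \<Sum>b\<in>Basis. (V x \<bullet> b) *\<^sub>R ?D b y) has_derivative
      (\<lambda>w. \<Sum>b\<in>Basis. (V x \<bullet> b) *\<^sub>R frechet_derivative (?D b) (at x) w)) (at x)"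
    by (intro has_derivative_sum has_derivative_scaleR_right D)
  then have "(?D (V x) has_derivative
      (\<lambda>w. \<Sum>b\<in>Basis. (V x \<bullet> b) *\<^sub>R frechet_derivative (?D b) (at x) w)) (at x)"
    by (rule has_derivative_transform_within_open[OF _ assms(1,2) expand])
  then have DV: "frechet_derivative (?D (V x)) (at x) w =
      (\<Sum>b\<in>Basis. (V x \<bullet> b) *\<^sub>R frechet_derivative (?D b) (at x) w)" for w
    by (simp add: frechet_derivative_at[symmetric])
  have "((\<lambda>y. \<Sum>b\<in>Basis. (V y \<bullet> b) *\<^sub>R ?D b y) has_derivative
      (\<lambda>w. \<Sum>b\<in>Basis. (V x \<bullet> b) *\<^sub>R frechet_derivative (?D b) (at x) w
        + (frechet_derivative V (at x) w \<bullet> b) *\<^sub>R ?D b x)) (at x)"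
    by (intro has_derivative_sum has_derivative_scaleR has_derivative_inner_left V D)
  then have "((\<lambda>y. frechet_derivative \<psi> (at y) (V y)) has_derivative
      (\<lambda>w. \<Sum>b\<in>Basis. (V x \<bullet> b) *\<^sub>R frechet_derivative (?D b) (at x) w
        + (frechet_derivative V (at x) w \<bullet> b) *\<^sub>R ?D b x)) (at x)"
    by (rule has_derivative_transform_within_open[OF _ assms(1,2) expand])
  then show ?thesis
    by (simp add: sum.distrib DV expand[OF assms(2)])
qed

text \<open>The second derivatives of \<psi> cancel by symmetry. With \<psi> a transition map this
  says that the coordinate formula for the bracket is independent of the chart; with \<psi> a
  function in coordinates it is [X,Y]f = XYf - YXf.\<close>

lemma frechet_derivative_bracket:
  fixes \<psi> :: "'a::euclidean_space \<Rightarrow> 'b::euclidean_space"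
  assumes "open S" "x \<in> S" "smooth_on S \<psi>" "smooth_on S U" "smooth_on S V"
  shows "frechet_derivative (\<lambda>y. frechet_derivative \<psi> (at y) (V y)) (at x) (U x)
       - frechet_derivative (\<lambda>y. frechet_derivative \<psi> (at y) (U y)) (at x) (V x)
       = frechet_derivative \<psi> (at x)
           (frechet_derivative V (at x) (U x) - frechet_derivative U (at x) (V x))"
proof -
  have "linear (frechet_derivative \<psi> (at x))"
    using assms(2,3) smooth_on_imp_differentiable linear_frechet_derivative by blast
  then show ?thesis
    using second_derivative_symmetric[OF assms(1,2,3), of "V x" "U x"]
    by (simp add: linear_diff
        frechet_derivative_at[OF has_derivative_frechet_derivative_field[OF assms(1-3,5)], symmetric]
        frechet_derivative_at[OF has_derivative_frechet_derivative_field[OF assms(1-3,4)], symmetric])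
qed

section \<open>Charts, transition maps and change of components\<close>

definition overlap :: "('m, 'n::finite) chart \<Rightarrow> ('m, 'n) chart \<Rightarrow> (real ^ 'n) set" where
  "overlap c d = chart_map c ` (chart_dom c \<inter> chart_dom d)"

definition transition :: "('m, 'n::finite) chart \<Rightarrow> ('m, 'n) chart \<Rightarrow> real ^ 'n \<Rightarrow> real ^ 'n" where
  "transition c d = chart_map d \<circ> chart_inv c"

definition jac :: "('m, 'n::finite) chart \<Rightarrow> ('m, 'n) chart \<Rightarrow> real ^ 'n \<Rightarrow> real ^ 'n \<Rightarrow> real ^ 'n" where
  "jac c d x = frechet_derivative (transition c d) (at x)"

definition field_coords ::
  "('m, 'n::finite) chart set \<Rightarrow> ('m, 'n) chart \<Rightarrow> ('m \<Rightarrow> real ^ 'n) \<Rightarrow> real ^ 'n \<Rightarrow> real ^ 'n" where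
  "field_coords A c X x = tangent_coords A c (chart_inv c x) (X (chart_inv c x))"

text \<open>Tangent vectors at q are stored as components in \<open>chart_at A q\<close>, so reading
  them in c is a change of chart.\<close>

lemma tangent_coords_jac: "tangent_coords A c q v = jac (chart_at A q) c (chart_map (chart_at A q) q) v"
  by (simp add: tangent_coords_def jac_def transition_def)

locale manifold =
  fixes A :: "('m::{t2_space, second_countable_topology}, 'n::finite) chart set"
  assumes smooth_atlas: "smooth_atlas A"
begin

lemma open_chart_dom: "c \<in> A \<Longrightarrow> open (chart_dom c)"
  and open_chart_range: "c \<in> A \<Longrightarrow> open (chart_range c)"
  and chart_homeomorphism:
    "c \<in> A \<Longrightarrow> homeomorphism (chart_dom c) (chart_range c) (chart_map c) (chart_inv c)"
  and smooth_transition: "c \<in> A \<Longrightarrow> d \<in> A \<Longrightarrow> smooth_on (overlap c d) (transition c d)"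
  using smooth_atlas by (auto simp: smooth_atlas_def overlap_def transition_def)

lemma chart_inv_map: "c \<in> A \<Longrightarrow> q \<in> chart_dom c \<Longrightarrow> chart_inv c (chart_map c q) = q"
  using chart_homeomorphism by (metis homeomorphism_apply1)

lemma chart_map_inv: "c \<in> A \<Longrightarrow> x \<in> chart_range c \<Longrightarrow> chart_map c (chart_inv c x) = x"
  using chart_homeomorphism by (metis homeomorphism_apply2)

lemma chart_inv_in_dom: "c \<in> A \<Longrightarrow> x \<in> chart_range c \<Longrightarrow> chart_inv c x \<in> chart_dom c"
  using chart_inv_map[of c] by auto

lemma chart_at: "chart_at A q \<in> A" "q \<in> chart_dom (chart_at A q)"
proof -
  have "\<exists>c. c \<in> A \<and> q \<in> chart_dom c"
    using smooth_atlas unfolding smooth_atlas_def by blast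
  from someI_ex[OF this] show "chart_at A q \<in> A" "q \<in> chart_dom (chart_at A q)"
    by (simp_all add: chart_at_def)
qed

lemma open_chart_image:
  assumes "c \<in> A" "open U" "U \<subseteq> chart_dom c"
  shows "open (chart_map c ` U)"
proof -
  have "openin (top_of_set (chart_range c)) (chart_map c ` U)"
    by (rule homeomorphism_imp_open_map[OF chart_homeomorphism[OF assms(1)]])
       (use assms in \<open>auto simp: openin_open_eq open_chart_dom\<close>)
  then show ?thesis
    using open_chart_range[OF assms(1)] openin_open_trans by blast
qed

lemma open_overlap: "c \<in> A \<Longrightarrow> d \<in> A \<Longrightarrow> open (overlap c d)"
  unfolding overlap_def by (intro open_chart_image open_Int open_chart_dom) auto

lemma overlap_subset: "overlap c d \<subseteq> chart_range c"
  by (auto simp: overlap_def)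

lemma overlap_iff:
  assumes "c \<in> A"
  shows "x \<in> overlap c d \<longleftrightarrow> x \<in> chart_range c \<and> chart_inv c x \<in> chart_dom d"
proof
  assume "x \<in> overlap c d"
  then obtain q where "q \<in> chart_dom c" "q \<in> chart_dom d" "x = chart_map c q"
    unfolding overlap_def by blast
  then show "x \<in> chart_range c \<and> chart_inv c x \<in> chart_dom d"
    using chart_inv_map[OF assms] by simp
next
  assume x: "x \<in> chart_range c \<and> chart_inv c x \<in> chart_dom d"
  then have "chart_map c (chart_inv c x) = x" "chart_inv c x \<in> chart_dom c \<inter> chart_dom d"
    using chart_map_inv[OF assms] chart_inv_in_dom[OF assms] by blast+
  then show "x \<in> overlap c d" unfolding overlap_def by (metis imageI)
qed

lemma chart_map_in_overlap: "q \<in> chart_dom c \<Longrightarrow> q \<in> chart_dom d \<Longrightarrow> chart_map c q \<in> overlap c d"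
  by (auto simp: overlap_def)

lemma transition_chart_map:
  "c \<in> A \<Longrightarrow> q \<in> chart_dom c \<Longrightarrow> transition c d (chart_map c q) = chart_map d q"
  by (simp add: transition_def chart_inv_map)

lemma transition_in_overlap: "c \<in> A \<Longrightarrow> x \<in> overlap c d \<Longrightarrow> transition c d x \<in> overlap d c"
  by (auto simp: overlap_def transition_chart_map)

lemma chart_inv_transition:
  "c \<in> A \<Longrightarrow> d \<in> A \<Longrightarrow> x \<in> overlap c d \<Longrightarrow> chart_inv d (transition c d x) = chart_inv c x"
  by (auto simp: overlap_def transition_chart_map chart_inv_map)

lemma transition_differentiable:
  "c \<in> A \<Longrightarrow> d \<in> A \<Longrightarrow> x \<in> overlap c d \<Longrightarrow> transition c d differentiable (at x)"
  using smooth_transition smooth_on_imp_differentiable by blast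

lemma linear_jac: "c \<in> A \<Longrightarrow> d \<in> A \<Longrightarrow> x \<in> overlap c d \<Longrightarrow> linear (jac c d x)"
  unfolding jac_def by (intro linear_frechet_derivative transition_differentiable)

text \<open>The transition maps compose on an open set around the point, which suffices for their
  derivatives. This cocycle rule underlies the changes of components below.\<close>

lemma jac_chain:
  assumes "c \<in> A" "d \<in> A" "e \<in> A" "q \<in> chart_dom c" "q \<in> chart_dom d" "q \<in> chart_dom e"
  shows "jac c e (chart_map c q) v = jac d e (chart_map d q) (jac c d (chart_map c q) v)"
proof -
  let ?x = "chart_map c q"
  have x: "?x \<in> overlap c d" "?x \<in> overlap c e" "transition c d ?x \<in> overlap d e"
    using assms by (auto simp: overlap_def transition_chart_map)
  have 1: "frechet_derivative (transition c e) (at ?x) =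
      frechet_derivative (\<lambda>x. transition d e (transition c d x)) (at ?x)"
  proof (rule frechet_derivative_transform_within_open[where X = "overlap c d \<inter> overlap c e"])
    show "transition c e y = transition d e (transition c d y)" if "y \<in> overlap c d \<inter> overlap c e" for y
      using that chart_inv_transition[OF assms(1,2), of y] by (simp add: transition_def)
  qed (use assms x in \<open>auto intro: transition_differentiable open_overlap\<close>)
  have "frechet_derivative (\<lambda>x. transition d e (transition c d x)) (at ?x) v =
      jac d e (transition c d ?x) (jac c d ?x v)"
    unfolding jac_def using assms x
    by (intro frechet_derivative_chain transition_differentiable) auto
  with 1 show ?thesis
    using assms by (simp add: jac_def transition_chart_map)
qed

lemma jac_same:
  assumes "c \<in> A" "q \<in> chart_dom c"
  shows "jac c c (chart_map c q) v = v"
proof -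
  let ?x = "chart_map c q"
  have "frechet_derivative (transition c c) (at ?x) = frechet_derivative (\<lambda>x. x) (at ?x)"
    by (rule frechet_derivative_transform_within_open[where X = "overlap c c"])
       (use assms in \<open>auto intro!: transition_differentiable open_overlap chart_map_in_overlap\<close>,
        auto simp: overlap_def transition_chart_map)
  then show ?thesis by (simp add: jac_def)
qed

lemma tangent_coords_chart_at: "tangent_coords A (chart_at A q) q v = v"
  by (simp add: tangent_coords_jac jac_same chart_at)

lemma tangent_coords_change:
  assumes "c \<in> A" "d \<in> A" "q \<in> chart_dom c" "q \<in> chart_dom d"
  shows "tangent_coords A d q v = jac c d (chart_map c q) (tangent_coords A c q v)"
  unfolding tangent_coords_jac by (rule jac_chain) (use assms chart_at in auto)

lemma linear_tangent_coords: "c \<in> A \<Longrightarrow> q \<in> chart_dom c \<Longrightarrow> linear (tangent_coords A c q)"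
  unfolding tangent_coords_jac[abs_def] by (intro linear_jac chart_map_in_overlap chart_at)

text \<open>The Jacobian back to the preferred chart is a left inverse, so vectors may be compared
  in any convenient chart.\<close>

lemma tangent_coords_inj:
  assumes "c \<in> A" "q \<in> chart_dom c" "tangent_coords A c q v = tangent_coords A c q w"
  shows "v = w"
  using tangent_coords_change[OF assms(1) chart_at(1) assms(2) chart_at(2)] assms(3)
  by (metis tangent_coords_chart_at)

section \<open>Smooth functions and vector fields in coordinates\<close>

lemma field_coords_chart_map:
  "c \<in> A \<Longrightarrow> q \<in> chart_dom c \<Longrightarrow> field_coords A c X (chart_map c q) = tangent_coords A c q (X q)"
  by (simp add: field_coords_def chart_inv_map)

lemma vector_field_iff: "vector_field A X \<longleftrightarrow> (\<forall>c\<in>A. smooth_on (chart_range c) (field_coords A c X))"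
  by (simp add: vector_field_def field_coords_def[abs_def])

lemma field_coords_transition:
  assumes "c \<in> A" "d \<in> A" "x \<in> overlap c d"
  shows "field_coords A d X (transition c d x) = jac c d x (field_coords A c X x)"
  using assms tangent_coords_change[OF assms(1,2)]
  by (auto simp: overlap_def transition_chart_map field_coords_chart_map)

lemma smooth_field_coords: "vector_field A X \<Longrightarrow> c \<in> A \<Longrightarrow> smooth_on (chart_range c) (field_coords A c X)"
  by (simp add: vector_field_iff)

lemma smooth_function_chart:
  "smooth_function A f \<Longrightarrow> c \<in> A \<Longrightarrow> smooth_on (chart_range c) (f \<circ> chart_inv c)"
  by (simp add: smooth_function_def)

lemma smooth_function_const: "smooth_function A (\<lambda>q. k)"
  by (simp add: smooth_function_def o_def smooth_on_const)

lemma smooth_function_mult: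
  "smooth_function A f \<Longrightarrow> smooth_function A h \<Longrightarrow> smooth_function A (\<lambda>q. f q * h q)"
  by (auto simp: smooth_function_def o_def intro!: smooth_on_mult open_chart_range)

lemma vector_field_add:
  assumes "vector_field A X" "vector_field A Y"
  shows "vector_field A (\<lambda>q. X q + Y q)"
  unfolding vector_field_iff
proof
  fix c assume c: "c \<in> A"
  have "field_coords A c (\<lambda>q. X q + Y q) x = field_coords A c X x + field_coords A c Y x"
    if "x \<in> chart_range c" for x
    using linear_add[OF linear_tangent_coords[OF c chart_inv_in_dom[OF c that]]]
    by (simp add: field_coords_def)
  then show "smooth_on (chart_range c) (field_coords A c (\<lambda>q. X q + Y q))"
    by (rule smooth_on_transform[OF open_chart_range[OF c] smooth_on_add[OF open_chart_range[OF c]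
          smooth_field_coords[OF assms(1) c] smooth_field_coords[OF assms(2) c]]])
qed

lemma vector_field_scaleR:
  assumes "smooth_function A f" "vector_field A X"
  shows "vector_field A (\<lambda>q. f q *\<^sub>R X q)"
  unfolding vector_field_iff
proof
  fix c assume c: "c \<in> A"
  have "field_coords A c (\<lambda>q. f q *\<^sub>R X q) x = (f \<circ> chart_inv c) x *\<^sub>R field_coords A c X x"
    if "x \<in> chart_range c" for x
    using linear_cmul[OF linear_tangent_coords[OF c chart_inv_in_dom[OF c that]]]
    by (simp add: field_coords_def)
  then show "smooth_on (chart_range c) (field_coords A c (\<lambda>q. f q *\<^sub>R X q))"
    by (rule smooth_on_transform[OF open_chart_range[OF c] smooth_on_scaleR[OF open_chart_range[OF c]
          smooth_function_chart[OF assms(1) c] smooth_field_coords[OF assms(2) c]]])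
qed

lemma vector_field_cscaleR: "vector_field A X \<Longrightarrow> vector_field A (\<lambda>q. k *\<^sub>R X q)"
  by (rule vector_field_scaleR[OF smooth_function_const])

lemma vector_field_diff:
  assumes "vector_field A X" "vector_field A Y"
  shows "vector_field A (\<lambda>q. X q - Y q)"
  using vector_field_add[OF assms(1) vector_field_cscaleR[OF assms(2), of "-1"]] by simp

text \<open>\<open>vf_apply\<close> is defined in a chart that depends on q. In a fixed chart c one
  formula covers all q in its domain, so that \<open>vf_apply A X f\<close> can itself be
  differentiated.\<close>

lemma vf_apply_chart:
  assumes "c \<in> A" "q \<in> chart_dom c" "smooth_function A f"
  shows "vf_apply A X f q = frechet_derivative (f \<circ> chart_inv c) (at (chart_map c q)) (field_coords A c X (chart_map c q))"
proof -
  let ?e = "chart_at A q"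
  let ?x = "chart_map ?e q"
  have tr: "transition ?e c ?x = chart_map c q" by (simp add: transition_chart_map chart_at)
  have x: "?x \<in> overlap ?e c" using assms chart_at by (auto simp: chart_map_in_overlap)
  have fe: "(f \<circ> chart_inv ?e) differentiable (at ?x)"
    by (rule smooth_on_imp_differentiable[OF smooth_function_chart[OF assms(3) chart_at(1)]])
       (simp add: chart_at)
  have fc: "(f \<circ> chart_inv c) differentiable (at (transition ?e c ?x))"
    unfolding tr by (rule smooth_on_imp_differentiable[OF smooth_function_chart[OF assms(3,1)]]) (use assms in simp)
  have 1: "frechet_derivative (f \<circ> chart_inv ?e) (at ?x) =
      frechet_derivative (\<lambda>x. (f \<circ> chart_inv c) (transition ?e c x)) (at ?x)"
    by (rule frechet_derivative_transform_within_open[OF fe open_overlap[OF chart_at(1) assms(1)] x])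
       (simp add: chart_inv_transition chart_at assms)
  have "frechet_derivative (\<lambda>x. (f \<circ> chart_inv c) (transition ?e c x)) (at ?x) (X q) =
      frechet_derivative (f \<circ> chart_inv c) (at (transition ?e c ?x)) (jac ?e c ?x (X q))"
    unfolding jac_def by (rule frechet_derivative_chain[OF transition_differentiable[OF chart_at(1) assms(1) x] fc])
  with 1 show ?thesis
    by (simp add: vf_apply_def tr tangent_coords_jac field_coords_chart_map assms)
qed

lemma vf_apply_const: "vf_apply A X (\<lambda>q. k) q = 0"
  by (simp add: vf_apply_def o_def)

lemma vf_apply_chart_inv:
  assumes "c \<in> A" "x \<in> chart_range c" "smooth_function A f"
  shows "(vf_apply A X f \<circ> chart_inv c) x = frechet_derivative (f \<circ> chart_inv c) (at x) (field_coords A c X x)"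
  using vf_apply_chart[OF assms(1) chart_inv_in_dom[OF assms(1,2)] assms(3)] chart_map_inv[OF assms(1,2)] by simp

lemma smooth_function_vf_apply:
  assumes "vector_field A X" "smooth_function A f"
  shows "smooth_function A (vf_apply A X f)"
  unfolding smooth_function_def
proof
  fix c assume c: "c \<in> A"
  show "smooth_on (chart_range c) (vf_apply A X f \<circ> chart_inv c)"
    by (rule smooth_on_transform[OF open_chart_range[OF c] smooth_on_frechet_derivative_field[OF
          open_chart_range[OF c] smooth_function_chart[OF assms(2) c] smooth_field_coords[OF assms(1) c]]])
       (rule vf_apply_chart_inv[OF c _ assms(2)])
qed

subsection \<open>Globalising compactly supported local data\<close>

definition glob_fun :: "('m, 'n) chart \<Rightarrow> (real ^ 'n \<Rightarrow> real) \<Rightarrow> 'm \<Rightarrow> real" where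
  "glob_fun c F q = (if q \<in> chart_dom c then F (chart_map c q) else 0)"

text \<open>W lists components in c, whereas the value at q is stored in the preferred chart of q;
  the Jacobian converts.\<close>

definition glob_field :: "('m, 'n) chart \<Rightarrow> (real ^ 'n \<Rightarrow> real ^ 'n) \<Rightarrow> 'm \<Rightarrow> real ^ 'n" where
  "glob_field c W q =
     (if q \<in> chart_dom c then jac c (chart_at A q) (chart_map c q) (W (chart_map c q)) else 0)"

lemma tangent_coords_glob_field:
  assumes "c \<in> A" "q \<in> chart_dom c"
  shows "tangent_coords A c q (glob_field c W q) = W (chart_map c q)"
  using assms jac_chain[OF assms(1) chart_at(1) assms(1,2) chart_at(2) assms(2)]
  by (simp add: glob_field_def tangent_coords_jac jac_same)

text \<open>The support is compact, hence closed in the Hausdorff space \<open>M\<close>, so the range of any chart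
  \<open>d\<close> is covered by two open sets: the overlap with \<open>c\<close>, and the complement of the support.\<close>

lemma smooth_on_glob:
  fixes f :: "real ^ 'n \<Rightarrow> 'b::real_normed_vector"
  assumes "c \<in> A" "d \<in> A" "compact K" "K \<subseteq> chart_range c"
    and "smooth_on (overlap d c) f"
    and "\<And>q. q \<in> chart_dom d \<Longrightarrow> q \<notin> chart_inv c ` K \<Longrightarrow> f (chart_map d q) = 0"
  shows "smooth_on (chart_range d) f"
proof -
  let ?C = "chart_inv c ` K"
  let ?S = "chart_map d ` (chart_dom d - ?C)"
  have "continuous_on K (chart_inv c)"
    using homeomorphism_cont2[OF chart_homeomorphism[OF assms(1)]] assms(4) continuous_on_subset by blast
  then have "closed ?C"
    using assms(3) compact_continuous_image compact_imp_closed by blast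
  then have S: "open ?S"
    using assms(2) by (intro open_chart_image open_Diff open_chart_dom) auto
  have "?C \<subseteq> chart_dom c"
    using assms(1,4) chart_inv_in_dom by blast
  then have "chart_dom d \<subseteq> (chart_dom d \<inter> chart_dom c) \<union> (chart_dom d - ?C)"
    by blast
  then have "chart_range d \<subseteq> overlap d c \<union> ?S"
    unfolding overlap_def image_Un[symmetric] by (rule image_mono)
  moreover have "smooth_on ?S f \<longleftrightarrow> smooth_on ?S (\<lambda>x. 0 :: 'b)"
    by (rule smooth_on_cong[OF S]) (use assms(6) in auto)
  then have "smooth_on (overlap d c \<union> ?S) f"
    using assms(1,2,5) S by (intro smooth_on_Un open_overlap) (auto intro: smooth_on_const)
  ultimately show ?thesis using smooth_on_subset by blast
qed

lemma smooth_function_glob_fun: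
  assumes "c \<in> A" "compact K" "K \<subseteq> chart_range c"
    and "smooth_on (chart_range c) F" "\<And>x. x \<in> chart_range c \<Longrightarrow> x \<notin> K \<Longrightarrow> F x = 0"
  shows "smooth_function A (glob_fun c F)"
  unfolding smooth_function_def
proof
  fix d assume d: "d \<in> A"
  show "smooth_on (chart_range d) (glob_fun c F \<circ> chart_inv d)"
  proof (rule smooth_on_glob[OF assms(1) d assms(2,3)])
    have "smooth_on (overlap d c) (\<lambda>x. F (transition d c x))"
      by (rule smooth_on_compose[OF open_overlap[OF d assms(1)] open_chart_range[OF assms(1)] _
            smooth_transition[OF d assms(1)] assms(4)])
         (use transition_in_overlap[OF d] overlap_subset in blast)
    then show "smooth_on (overlap d c) (glob_fun c F \<circ> chart_inv d)"
      by (rule smooth_on_transform[OF open_overlap[OF d assms(1)]])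
         (simp add: glob_fun_def overlap_iff[OF d] transition_def)
    show "(glob_fun c F \<circ> chart_inv d) (chart_map d q) = 0"
      if q: "q \<in> chart_dom d" "q \<notin> chart_inv c ` K" for q
    proof -
      have "chart_map c q \<notin> K" if "q \<in> chart_dom c"
        using q that assms(1) chart_inv_map by (metis imageI)
      then show ?thesis
        using assms(5) chart_inv_map[OF d q(1)] by (simp add: glob_fun_def)
    qed
  qed
qed

lemma vector_field_glob_field:
  assumes "c \<in> A" "compact K" "K \<subseteq> chart_range c"
    and "smooth_on (chart_range c) W" "\<And>x. x \<in> chart_range c \<Longrightarrow> x \<notin> K \<Longrightarrow> W x = 0"
  shows "vector_field A (glob_field c W)"
  unfolding vector_field_iff
proof
  fix d assume d: "d \<in> A"
  show "smooth_on (chart_range d) (field_coords A d (glob_field c W))"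
  proof (rule smooth_on_glob[OF assms(1) d assms(2,3)])
    have "smooth_on (overlap c d) (\<lambda>y. jac c d y (W y))"
      unfolding jac_def
      by (rule smooth_on_frechet_derivative_field[OF open_overlap[OF assms(1) d] smooth_transition[OF assms(1) d]
            smooth_on_subset[OF assms(4) overlap_subset]])
    then have "smooth_on (overlap d c) (\<lambda>x. jac c d (transition d c x) (W (transition d c x)))"
      using smooth_on_compose[OF open_overlap[OF d assms(1)] open_overlap[OF assms(1) d] _
            smooth_transition[OF d assms(1)], of "\<lambda>y. jac c d y (W y)"] transition_in_overlap[OF d]
      by blast
    then show "smooth_on (overlap d c) (field_coords A d (glob_field c W))"
    proof (rule smooth_on_transform[OF open_overlap[OF d assms(1)]])
      fix x assume "x \<in> overlap d c"
      then obtain q where q: "q \<in> chart_dom d" "q \<in> chart_dom c" "x = chart_map d q"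
        by (auto simp: overlap_def)
      show "field_coords A d (glob_field c W) x = jac c d (transition d c x) (W (transition d c x))"
        using q d assms(1) tangent_coords_change[OF assms(1) d q(2,1)]
        by (simp add: field_coords_chart_map transition_chart_map tangent_coords_glob_field)
    qed
    show "field_coords A d (glob_field c W) (chart_map d q) = 0"
      if q: "q \<in> chart_dom d" "q \<notin> chart_inv c ` K" for q
    proof -
      have "glob_field c W q = 0"
      proof (cases "q \<in> chart_dom c")
        case True
        then have "chart_map c q \<notin> K"
          using q assms(1) chart_inv_map by (metis imageI)
        then have "W (chart_map c q) = 0" using True assms(5) by auto
        moreover have "linear (jac c (chart_at A q) (chart_map c q))"
          using True by (intro linear_jac chart_map_in_overlap chart_at assms)
        ultimately show ?thesis by (simp add: glob_field_def True linear_0)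
      qed (simp add: glob_field_def)
      then show ?thesis
        using q d linear_0[OF linear_tangent_coords[OF d q(1)]] by (simp add: field_coords_chart_map)
    qed
  qed
qed

lemma cutoff:
  assumes "c \<in> A" "q \<in> chart_dom c"
  obtains h :: "real ^ 'n \<Rightarrow> real" and K where "smooth_on (chart_range c) h" "h (chart_map c q) = 1"
    "compact K" "K \<subseteq> chart_range c" "\<And>x. x \<notin> K \<Longrightarrow> h x = 0"
proof -
  obtain r where r: "r > 0" "cball (chart_map c q) r \<subseteq> chart_range c"
    using open_chart_range[OF assms(1)] assms(2) open_contains_cball by blast
  obtain h :: "real ^ 'n \<Rightarrow> real" where "smooth_on UNIV h" "h (chart_map c q) = 1"
    "\<And>x. x \<notin> cball (chart_map c q) r \<Longrightarrow> h x = 0"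
    using bump_function[OF r(1)] by blast
  then show ?thesis
    using that[OF _ _ compact_cball r(2)] smooth_on_subset by blast
qed

text \<open>The constant coordinate field v, cut off around q. Its existence makes the choice in
  \<open>extend\<close> meaningful.\<close>

lemma vector_field_through: "\<exists>X. vector_field A X \<and> X q = v"
proof -
  let ?c = "chart_at A q"
  obtain h :: "real ^ 'n \<Rightarrow> real" and K where h: "smooth_on (chart_range ?c) h" "h (chart_map ?c q) = 1"
    "compact K" "K \<subseteq> chart_range ?c" "\<And>x. x \<notin> K \<Longrightarrow> h x = 0"
    using cutoff[OF chart_at, of q] by blast
  let ?W = "\<lambda>x. h x *\<^sub>R v"
  have "smooth_on (chart_range ?c) ?W"
    by (intro smooth_on_scaleR h smooth_on_const open_chart_range chart_at)
  then have "vector_field A (glob_field ?c ?W)"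
    using h by (intro vector_field_glob_field chart_at) auto
  moreover have "glob_field ?c ?W q = v"
    using tangent_coords_glob_field[OF chart_at, of q ?W] h(2) by (simp add: tangent_coords_chart_at)
  ultimately show ?thesis by blast
qed

lemma vector_field_extend: "vector_field A (extend A q v)"
  and extend_at: "extend A q v q = v"
  using someI_ex[OF vector_field_through[of q v]] by (auto simp: extend_def)

subsection \<open>Tensoriality\<close>

text \<open>Near \<open>q\<close>, \<open>h\<^sup>2 X\<close> is the combination \<open>\<Sum>i. (h X\<^sup>i) (h \<partial>\<^sub>i)\<close> of global fields with global
  coefficients, where \<open>h\<close> is a cutoff at \<open>q\<close>.\<close>

lemma tensorial_zero:
  fixes T :: "('m \<Rightarrow> real ^ 'n) \<Rightarrow> 'b::real_vector"
  assumes add: "\<And>X Y. vector_field A X \<Longrightarrow> vector_field A Y \<Longrightarrow> T (\<lambda>p. X p + Y p) = T X + T Y"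
    and scale: "\<And>f X. smooth_function A f \<Longrightarrow> vector_field A X \<Longrightarrow> T (\<lambda>p. f p *\<^sub>R X p) = f q *\<^sub>R T X"
    and X: "vector_field A X" "X q = 0"
  shows "T X = 0"
proof -
  have zero: "vector_field A (\<lambda>p. 0)" "T (\<lambda>p. 0) = 0"
    using vector_field_cscaleR[OF X(1), of 0] scale[OF smooth_function_const X(1), of 0] by simp_all
  have sum: "vector_field A (\<lambda>p. \<Sum>i\<in>I. F i p *\<^sub>R E i p) \<and>
      T (\<lambda>p. \<Sum>i\<in>I. F i p *\<^sub>R E i p) = (\<Sum>i\<in>I. F i q *\<^sub>R T (E i))"
    if "finite I" "\<And>i. smooth_function A (F i)" "\<And>i. vector_field A (E i)"
    for I :: "'n set" and F E
    using that(1) by (induction I) (simp_all add: zero vector_field_add add scale vector_field_scaleR that)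
  let ?c = "chart_at A q"
  note c = chart_at(1)[of q]
  obtain h :: "real ^ 'n \<Rightarrow> real" and K where h: "smooth_on (chart_range ?c) h" "h (chart_map ?c q) = 1"
    "compact K" "K \<subseteq> chart_range ?c" "\<And>x. x \<notin> K \<Longrightarrow> h x = 0"
    using cutoff[OF chart_at, of q] by blast
  define H where "H = glob_fun ?c h"
  define F where "F i = glob_fun ?c (\<lambda>x. h x * (field_coords A ?c X x) $ i)" for i
  define E where "E i = glob_field ?c (\<lambda>x. h x *\<^sub>R axis i (1::real))" for i
  have H: "smooth_function A H" "H q = 1"
    unfolding H_def using h chart_at(2)
    by (auto intro!: smooth_function_glob_fun[OF c h(3,4,1)] simp: glob_fun_def)
  have F: "smooth_function A (F i)" for i
    unfolding F_def
    by (intro smooth_function_glob_fun[OF c h(3,4)] smooth_on_mult open_chart_range c h(1)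
        smooth_on_linear_compose[OF _ bounded_linear_vec_nth] smooth_field_coords X) (use h in auto)
  have E: "vector_field A (E i)" for i
    unfolding E_def
    by (intro vector_field_glob_field[OF c h(3,4)] smooth_on_scaleR open_chart_range c h(1) smooth_on_const)
       (use h in auto)
  have eq: "(H p * H p) *\<^sub>R X p = (\<Sum>i\<in>UNIV. F i p *\<^sub>R E i p)" for p
  proof (cases "p \<in> chart_dom ?c")
    case True
    let ?x = "chart_map ?c p"
    note lin = linear_tangent_coords[OF c True]
    show ?thesis
    proof (rule tangent_coords_inj[OF c True])
      have "tangent_coords A ?c p (\<Sum>i\<in>UNIV. F i p *\<^sub>R E i p) =
          (\<Sum>i\<in>UNIV. (h ?x * (field_coords A ?c X ?x) $ i) *\<^sub>R (h ?x *\<^sub>R axis i 1))"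
        using lin True tangent_coords_glob_field[OF c True]
        by (simp add: linear_sum linear_cmul F_def E_def glob_fun_def)
      also have "\<dots> = (h ?x * h ?x) *\<^sub>R field_coords A ?c X ?x"
        by (simp add: vec_eq_iff axis_def if_distrib[of "\<lambda>z. _ * z"] cong: if_cong)
      finally show "tangent_coords A ?c p ((H p * H p) *\<^sub>R X p) =
          tangent_coords A ?c p (\<Sum>i\<in>UNIV. F i p *\<^sub>R E i p)"
        using lin True by (simp add: linear_cmul H_def glob_fun_def field_coords_chart_map c)
    qed
  qed (simp add: H_def F_def glob_fun_def)
  have F0: "F i q = 0" for i
    using linear_0[OF linear_tangent_coords[OF chart_at]] X(2)
    by (simp add: F_def glob_fun_def chart_at field_coords_chart_map)
  \<comment> \<open>Scaling by \<open>H p * H p\<close> does not change T X, because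
    \<open>H q = 1\<close>; on the right the coefficients \<open>F i q\<close> vanish because X
    does.\<close>
  have "T X = T (\<lambda>p. (H p * H p) *\<^sub>R X p)"
    using scale[OF smooth_function_mult[OF H(1) H(1)] X(1)] H(2) by simp
  also have "\<dots> = (\<Sum>i\<in>UNIV. F i q *\<^sub>R T (E i))"
    unfolding eq using sum[of UNIV F E] F E by simp
  finally show ?thesis by (simp add: F0)
qed

lemma tensorial:
  fixes T :: "('m \<Rightarrow> real ^ 'n) \<Rightarrow> 'b::real_vector"
  assumes add: "\<And>X Y. vector_field A X \<Longrightarrow> vector_field A Y \<Longrightarrow> T (\<lambda>p. X p + Y p) = T X + T Y"
    and scale: "\<And>f X. smooth_function A f \<Longrightarrow> vector_field A X \<Longrightarrow> T (\<lambda>p. f p *\<^sub>R X p) = f q *\<^sub>R T X"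
    and XY: "vector_field A X" "vector_field A Y" "X q = Y q"
  shows "T X = T Y"
proof -
  have "T (\<lambda>p. X p - Y p) = 0"
    by (rule tensorial_zero[OF add scale vector_field_diff[OF XY(1,2)]]) (simp_all add: XY(3))
  then show ?thesis
    using add[OF vector_field_diff[OF XY(1,2)] XY(2)] by simp
qed

text \<open>\<open>extend\<close> is an arbitrary choice, so the extension of a sum and the sum of
  the extensions are known to agree only at q; by \<open>tensorial\<close> this is enough.\<close>

lemma linear_tensorial_extend:
  fixes T :: "('m \<Rightarrow> real ^ 'n) \<Rightarrow> 'b::real_vector"
  assumes add: "\<And>X Y. vector_field A X \<Longrightarrow> vector_field A Y \<Longrightarrow> T (\<lambda>p. X p + Y p) = T X + T Y"
    and scale: "\<And>f X. smooth_function A f \<Longrightarrow> vector_field A X \<Longrightarrow> T (\<lambda>p. f p *\<^sub>R X p) = f q *\<^sub>R T X"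
  shows "linear (\<lambda>v. T (extend A q v))"
proof (rule linearI)
  fix v w k
  have "T (extend A q (v + w)) = T (\<lambda>p. extend A q v p + extend A q w p)"
    by (rule tensorial[where T = T, OF add scale])
       (auto intro: vector_field_extend vector_field_add simp: extend_at)
  then show "T (extend A q (v + w)) = T (extend A q v) + T (extend A q w)"
    by (simp only: add[OF vector_field_extend vector_field_extend])
  have "T (extend A q (k *\<^sub>R v)) = T (\<lambda>p. k *\<^sub>R extend A q v p)"
    by (rule tensorial[where T = T, OF add scale])
       (auto intro: vector_field_extend vector_field_cscaleR simp: extend_at)
  then show "T (extend A q (k *\<^sub>R v)) = k *\<^sub>R T (extend A q v)"
    by (simp only: scale[OF smooth_function_const vector_field_extend])
qed

subsection \<open>The Lie bracket\<close>

lemma vf_apply_separates: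
  assumes "\<And>f. smooth_function A f \<Longrightarrow> vf_apply A X f q = vf_apply A Y f q"
  shows "X q = Y q"
proof -
  let ?c = "chart_at A q"
  let ?x = "chart_map ?c q"
  note c = chart_at(1)[of q]
  obtain h :: "real ^ 'n \<Rightarrow> real" and K where h: "smooth_on (chart_range ?c) h" "h ?x = 1"
    "compact K" "K \<subseteq> chart_range ?c" "\<And>x. x \<notin> K \<Longrightarrow> h x = 0"
    using cutoff[OF chart_at, of q] by blast
  have x: "?x \<in> chart_range ?c" by (simp add: chart_at)
  have "X q $ i = Y q $ i" for i
  proof -
    \<comment> \<open>The i-th coordinate, cut off and centred at \<open>?x\<close>: as the second
      factor vanishes there, the derivative of h drops out of the Leibniz rule.\<close>
    define F where "F \<equiv> \<lambda>x. h x * (x - ?x) $ i"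
    have "smooth_function A (glob_fun ?c F)"
      unfolding F_def
      by (intro smooth_function_glob_fun[OF c h(3,4)] smooth_on_mult open_chart_range c h(1)
          smooth_on_linear_compose[OF _ bounded_linear_vec_nth] smooth_on_diff smooth_on_ident smooth_on_const)
         (use h in auto)
    moreover have "vf_apply A Z (glob_fun ?c F) q = Z q $ i" for Z
    proof -
      have "((\<lambda>x. x - ?x) has_derivative (\<lambda>w. w)) (at ?x)"
        by (auto intro!: derivative_eq_intros)
      then have "((\<lambda>x. (x - ?x) $ i) has_derivative (\<lambda>w. w $ i)) (at ?x)"
        by (rule bounded_linear.has_derivative[OF bounded_linear_vec_nth])
      from has_derivative_mult[OF smooth_on_imp_has_derivative[OF h(1) x] this]
      have "(F has_derivative (\<lambda>w. w $ i)) (at ?x)" by (simp add: F_def h(2))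
      then have "((glob_fun ?c F \<circ> chart_inv ?c) has_derivative (\<lambda>w. w $ i)) (at ?x)"
        by (rule has_derivative_transform_within_open[OF _ open_chart_range[OF c] x])
           (use chart_map_inv[OF c] chart_inv_in_dom[OF c] in \<open>auto simp: glob_fun_def\<close>)
      from frechet_derivative_at[OF this, symmetric] show ?thesis
        by (simp add: vf_apply_def)
    qed
    ultimately show ?thesis using assms[of "glob_fun ?c F"] by simp
  qed
  then show ?thesis by (simp add: vec_eq_iff)
qed

text \<open>The classical X^j d_j Y^i - Y^j d_j X^i in the preferred chart, a witness for the
  definite description in \<open>lie_bracket\<close>.\<close>

definition bracket :: "('m \<Rightarrow> real ^ 'n) \<Rightarrow> ('m \<Rightarrow> real ^ 'n) \<Rightarrow> 'm \<Rightarrow> real ^ 'n" where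
  "bracket X Y q =
     (let c = chart_at A q; x = chart_map c q in
        frechet_derivative (field_coords A c Y) (at x) (field_coords A c X x)
        - frechet_derivative (field_coords A c X) (at x) (field_coords A c Y x))"

text \<open>The preferred chart varies with the point, so smoothness requires the same formula in
  every chart; the bracket identity for the transition map supplies it.\<close>

lemma field_coords_bracket:
  assumes X: "vector_field A X" and Y: "vector_field A Y" and d: "d \<in> A" and y: "y \<in> chart_range d"
  shows "field_coords A d (bracket X Y) y =
    frechet_derivative (field_coords A d Y) (at y) (field_coords A d X y)
    - frechet_derivative (field_coords A d X) (at y) (field_coords A d Y y)"
proof -
  define q where "q = chart_inv d y"
  define c where "c = chart_at A q"
  define x where "x = chart_map c q"
  have q: "q \<in> chart_dom d" "q \<in> chart_dom c" "y = chart_map d q" and c: "c \<in> A"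
    using d y chart_at by (auto simp: q_def c_def chart_map_inv chart_inv_in_dom)
  have x: "x \<in> overlap c d" "transition c d x = y"
    using q c by (auto simp: x_def chart_map_in_overlap transition_chart_map)
  note S = open_overlap[OF c d]
  have smooth: "smooth_on (overlap c d) (field_coords A c Z)" if "vector_field A Z" for Z
    using smooth_on_subset[OF smooth_field_coords[OF that c] overlap_subset] .
  \<comment> \<open>The transformation law of V, that \<open>field_coords A d V\<close> after the
    transition map is the Jacobian applied to \<open>field_coords A c V\<close>, differentiated in
    the direction of U.\<close>
  have *: "frechet_derivative (\<lambda>z. frechet_derivative (transition c d) (at z) (field_coords A c V z)) (at x) (field_coords A c U x)
      = frechet_derivative (field_coords A d V) (at y) (field_coords A d U y)"
    if U: "vector_field A U" and V: "vector_field A V" for U V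
  proof -
    have Vd: "field_coords A d V differentiable (at (transition c d x))"
      unfolding x(2) by (rule smooth_on_imp_differentiable[OF smooth_field_coords[OF V d] y])
    have td: "transition c d differentiable (at x)"
      by (rule transition_differentiable[OF c d x(1)])
    have "frechet_derivative (\<lambda>z. field_coords A d V (transition c d z)) (at x) =
      frechet_derivative (\<lambda>z. frechet_derivative (transition c d) (at z) (field_coords A c V z)) (at x)"
    proof (rule frechet_derivative_transform_within_open[OF _ S x(1)])
      show "(\<lambda>z. field_coords A d V (transition c d z)) differentiable at x"
        using differentiable_chain_at[OF td Vd] by (simp add: o_def)
      show "field_coords A d V (transition c d z) =
          frechet_derivative (transition c d) (at z) (field_coords A c V z)" if "z \<in> overlap c d" for z
        using field_coords_transition[OF c d that] by (simp add: jac_def)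
    qed
    moreover have "frechet_derivative (\<lambda>z. field_coords A d V (transition c d z)) (at x) (field_coords A c U x)
      = frechet_derivative (field_coords A d V) (at y) (field_coords A d U y)"
      using frechet_derivative_chain[OF td Vd] field_coords_transition[OF c d x(1), of U] x(2)
      by (simp add: jac_def)
    ultimately show ?thesis by simp
  qed
  have "field_coords A d (bracket X Y) y = jac c d x (bracket X Y q)"
    by (simp add: field_coords_def tangent_coords_jac q_def[symmetric] c_def[symmetric] x_def)
  also have "\<dots> = frechet_derivative (field_coords A d Y) (at y) (field_coords A d X y)
    - frechet_derivative (field_coords A d X) (at y) (field_coords A d Y y)"
    using frechet_derivative_bracket[OF S x(1) smooth_transition[OF c d] smooth[OF X] smooth[OF Y]]
    by (simp add: jac_def bracket_def Let_def c_def[symmetric] x_def[symmetric] * X Y)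
  finally show ?thesis .
qed

lemma vector_field_bracket:
  assumes "vector_field A X" "vector_field A Y"
  shows "vector_field A (bracket X Y)"
  unfolding vector_field_iff
proof
  fix d assume d: "d \<in> A"
  have "smooth_on (chart_range d) (\<lambda>y. frechet_derivative (field_coords A d Y) (at y) (field_coords A d X y)
    - frechet_derivative (field_coords A d X) (at y) (field_coords A d Y y))"
    by (intro smooth_on_diff smooth_on_frechet_derivative_field open_chart_range smooth_field_coords assms d)
  then show "smooth_on (chart_range d) (field_coords A d (bracket X Y))"
    by (rule smooth_on_transform[OF open_chart_range[OF d]]) (rule field_coords_bracket[OF assms d])
qed

lemma vf_apply_bracket:
  assumes X: "vector_field A X" and Y: "vector_field A Y" and f: "smooth_function A f"
  shows "vf_apply A (bracket X Y) f =
    (\<lambda>q. vf_apply A X (vf_apply A Y f) q - vf_apply A Y (vf_apply A X f) q)"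
proof
  fix q
  let ?c = "chart_at A q"
  let ?F = "f \<circ> chart_inv ?c"
  let ?x = "chart_map ?c q"
  note c = chart_at(1)[of q]
  note S = open_chart_range[OF c]
  have x: "?x \<in> chart_range ?c" by (simp add: chart_at)
  have *: "vf_apply A U (vf_apply A V f) q =
      frechet_derivative (\<lambda>y. frechet_derivative ?F (at y) (field_coords A ?c V y)) (at ?x) (field_coords A ?c U ?x)"
    if V: "vector_field A V" for U V
  proof -
    have "frechet_derivative (vf_apply A V f \<circ> chart_inv ?c) (at ?x) =
      frechet_derivative (\<lambda>y. frechet_derivative ?F (at y) (field_coords A ?c V y)) (at ?x)"
      by (rule frechet_derivative_transform_within_open[OF _ S x vf_apply_chart_inv[OF c _ f]])
         (rule smooth_on_imp_differentiable[OF smooth_function_chart[OF smooth_function_vf_apply[OF V f] c] x])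
    then show ?thesis
      by (simp add: vf_apply_chart[OF chart_at smooth_function_vf_apply[OF V f]])
  qed
  show "vf_apply A (bracket X Y) f q = vf_apply A X (vf_apply A Y f) q - vf_apply A Y (vf_apply A X f) q"
    using frechet_derivative_bracket[OF S x smooth_function_chart[OF f c] smooth_field_coords[OF X c]
        smooth_field_coords[OF Y c]]
    by (simp add: * X Y vf_apply_chart[OF chart_at f, of "bracket X Y"] field_coords_bracket[OF X Y c x])
qed

lemma lie_bracket_eq:
  assumes "vector_field A X" "vector_field A Y"
  shows "lie_bracket A X Y = bracket X Y"
  unfolding lie_bracket_def
proof (rule the_equality)
  show "vector_field A (bracket X Y) \<and> (\<forall>f. smooth_function A f \<longrightarrow>
      vf_apply A (bracket X Y) f = (\<lambda>q. vf_apply A X (vf_apply A Y f) q - vf_apply A Y (vf_apply A X f) q))"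
    using vector_field_bracket vf_apply_bracket assms by blast
next
  fix Z
  assume "vector_field A Z \<and> (\<forall>f. smooth_function A f \<longrightarrow>
      vf_apply A Z f = (\<lambda>q. vf_apply A X (vf_apply A Y f) q - vf_apply A Y (vf_apply A X f) q))"
  then show "Z = bracket X Y"
    using vf_apply_bracket[OF assms] by (intro ext vf_apply_separates) simp
qed

lemma vf_apply_lie_bracket:
  assumes "vector_field A X" "vector_field A Y" "smooth_function A f"
  shows "vf_apply A (lie_bracket A X Y) f q = vf_apply A X (vf_apply A Y f) q - vf_apply A Y (vf_apply A X f) q"
  using vf_apply_bracket[OF assms] lie_bracket_eq[OF assms(1,2)] by simp

end

section \<open>Curvature of the semi-symmetric metric connection\<close>

lemma trace_matrix: "trace (matrix f) = (\<Sum>i\<in>UNIV. f (axis i 1) $ i)"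
  by (simp add: trace_def matrix_def)

text \<open>A contraction in the coordinate basis; it stands in for the classical sum over an
  orthonormal frame.\<close>

lemma sum_component_linear:
  fixes f :: "real ^ 'n \<Rightarrow> real"
  assumes "linear f"
  shows "(\<Sum>i\<in>UNIV. f (axis i 1) * v $ i) = f v"
proof -
  have "f v = f (\<Sum>i\<in>UNIV. v $ i *\<^sub>R axis i 1)"
    by (simp add: basis_expansion[of v, unfolded scalar_mult_eq_scaleR])
  then show ?thesis using assms by (simp add: linear_sum linear_cmul mult.commute)
qed

lemma sum_axis_component: "(\<Sum>i\<in>UNIV. (axis i 1 :: real ^ 'n) $ i) = real CARD('n)"
  by simp

locale semi_symmetric = manifold A
  for A :: "('m::{t2_space, second_countable_topology}, 'n::finite) chart set" +
  fixes g :: "'m \<Rightarrow> real ^ 'n \<Rightarrow> real ^ 'n \<Rightarrow> real"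
    and D :: "('m, 'n) connection"
    and \<rho> :: "'m \<Rightarrow> real ^ 'n"
  assumes metric: "pseudo_riemannian_metric A g"
    and levi_civita: "levi_civita A g D"
    and vector_field_rho: "vector_field A \<rho>"
begin

abbreviation \<pi> :: "'m \<Rightarrow> real ^ 'n \<Rightarrow> real" where
  "\<pi> \<equiv> dual_form g \<rho>"

abbreviation D' :: "('m, 'n) connection" where
  "D' \<equiv> semi_symmetric_connection g \<rho> D"

section \<open>Linear algebra of the metric: duality and traces\<close>

lemma bilinear_metric: "bilinear (g q)"
  and metric_sym: "g q u v = g q v u"
  and metric_nondegenerate: "(\<And>v. g q u v = 0) \<Longrightarrow> u = 0"
  and smooth_function_metric:
    "vector_field A X \<Longrightarrow> vector_field A Y \<Longrightarrow> smooth_function A (\<lambda>q. g q (X q) (Y q))"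
  using metric unfolding pseudo_riemannian_metric_def by blast+

lemmas metric_simps =
  bilinear_ladd[OF bilinear_metric] bilinear_radd[OF bilinear_metric]
  bilinear_lmul[OF bilinear_metric] bilinear_rmul[OF bilinear_metric]
  bilinear_lsub[OF bilinear_metric] bilinear_rsub[OF bilinear_metric]

lemma linear_metric_left: "linear (\<lambda>u. g q u v)"
  using bilinear_metric by (simp add: bilinear_def)

lemma metric_eqI:
  assumes "\<And>v. g q u v = g q w v"
  shows "u = w"
  using metric_nondegenerate[of q "u - w"] assms by (simp add: metric_simps)

text \<open>The map from u to the coordinates of g(u, .) is injective by nondegeneracy, hence
  surjective by dimension.\<close>

lemma riesz:
  assumes "linear f"
  obtains w where "\<And>v. f v = g q w v"
proof -
  let ?G = "\<lambda>u. \<chi> i. g q u (axis i 1)"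
  have G: "(\<Sum>i\<in>UNIV. g q u (axis i 1) * v $ i) = g q u v" for u v
    by (rule sum_component_linear) (use bilinear_metric in \<open>simp add: bilinear_def\<close>)
  have "linear ?G"
    by (rule linearI) (simp_all add: vec_eq_iff metric_simps)
  moreover have "inj ?G"
  proof (rule injI)
    fix u w assume "?G u = ?G w"
    then have eq: "g q u (axis i 1) = g q w (axis i 1)" for i by (simp add: vec_eq_iff)
    show "u = w"
    proof (rule metric_eqI)
      show "g q u v = g q w v" for v
        by (simp only: G[of u v, symmetric] G[of w v, symmetric] eq)
    qed
  qed
  ultimately have "surj ?G" using linear_injective_imp_surjective[of ?G] by simp
  then obtain w where "(\<chi> i. f (axis i 1)) = ?G w" by (blast dest: surjD)
  then have "f (axis i 1) = g q w (axis i 1)" for i by (simp add: vec_eq_iff)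
  then have "f v = g q w v" for v
    by (simp only: sum_component_linear[OF assms, of v, symmetric] G[of w v, symmetric])
  then show ?thesis by (rule that)
qed

text \<open>Nondegeneracy makes \<open>L u\<close> the unique solution in the definite description,
  so a trace can be computed once a representing L is exhibited.\<close>

lemma metric_trace_eq:
  assumes "\<And>u v. T u v = g q (L u) v"
  shows "metric_trace (g q) T = (\<Sum>i\<in>UNIV. L (axis i 1) $ i)"
proof -
  have "(THE w. \<forall>v. g q w v = T u v) = L u" for u
    by (rule the_equality) (use assms metric_eqI[of q _ "L u"] in auto)
  then show ?thesis by (simp add: metric_trace_def trace_matrix)
qed

section \<open>The Levi-Civita connection and its curvature\<close>

lemma affine: "affine_connection A D"
  using levi_civita by (simp add: levi_civita_def)

lemma vector_field_D: "vector_field A X \<Longrightarrow> vector_field A Y \<Longrightarrow> vector_field A (D X Y)"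
  using affine by (simp add: affine_connection_def)

lemma D_add_left:
  "vector_field A X \<Longrightarrow> vector_field A X' \<Longrightarrow> vector_field A Y \<Longrightarrow>
    D (\<lambda>q. X q + X' q) Y q = D X Y q + D X' Y q"
  using affine by (simp add: affine_connection_def)

lemma D_scale_left:
  "smooth_function A f \<Longrightarrow> vector_field A X \<Longrightarrow> vector_field A Y \<Longrightarrow>
    D (\<lambda>q. f q *\<^sub>R X q) Y q = f q *\<^sub>R D X Y q"
  using affine by (simp add: affine_connection_def)

text \<open>An equality of fields rather than of values at q, since the curvature differentiates the
  result again.\<close>

lemma D_add_right_fun:
  "vector_field A X \<Longrightarrow> vector_field A Y \<Longrightarrow> vector_field A Y' \<Longrightarrow>
    D X (\<lambda>q. Y q + Y' q) = (\<lambda>q. D X Y q + D X Y' q)"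
  using affine by (simp add: affine_connection_def)

lemma D_scale_right_fun:
  "smooth_function A f \<Longrightarrow> vector_field A X \<Longrightarrow> vector_field A Y \<Longrightarrow>
    D X (\<lambda>q. f q *\<^sub>R Y q) = (\<lambda>q. vf_apply A X f q *\<^sub>R Y q + f q *\<^sub>R D X Y q)"
  using affine by (simp add: affine_connection_def)

lemma D_diff_right_fun:
  assumes "vector_field A X" "vector_field A Y" "vector_field A Y'"
  shows "D X (\<lambda>q. Y q - Y' q) = (\<lambda>q. D X Y q - D X Y' q)"
proof -
  have "D X (\<lambda>q. Y q + (-1) *\<^sub>R Y' q) = (\<lambda>q. D X Y q + (-1) *\<^sub>R D X Y' q)"
    using D_add_right_fun[OF assms(1,2) vector_field_cscaleR[OF assms(3), of "-1"]]
      D_scale_right_fun[OF smooth_function_const assms(1,3), of "-1"]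
    by (simp add: vf_apply_const)
  then show ?thesis by simp
qed

lemma metric_compatible:
  "vector_field A X \<Longrightarrow> vector_field A Y \<Longrightarrow> vector_field A Z \<Longrightarrow>
    vf_apply A X (\<lambda>q. g q (Y q) (Z q)) q = g q (D X Y q) (Z q) + g q (Y q) (D X Z q)"
  using levi_civita by (simp add: levi_civita_def)

lemma lie_bracket_torsion:
  "vector_field A X \<Longrightarrow> vector_field A Y \<Longrightarrow> lie_bracket A X Y = (\<lambda>q. D X Y q - D Y X q)"
  using levi_civita by (simp add: levi_civita_def)

lemma vector_field_lie_bracket:
  "vector_field A X \<Longrightarrow> vector_field A Y \<Longrightarrow> vector_field A (lie_bracket A X Y)"
  by (simp add: lie_bracket_torsion vector_field_diff vector_field_D)

lemma curvature_add:
  assumes "vector_field A X" "vector_field A Y" "vector_field A Z" "vector_field A Z'"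
  shows "curvature A D X Y (\<lambda>p. Z p + Z' p) q = curvature A D X Y Z q + curvature A D X Y Z' q"
  using assms by (simp add: curvature_def D_add_right_fun vector_field_D vector_field_lie_bracket)

text \<open>Besides f R(X,Y)Z the expansion leaves (XYf - YXf - [X,Y]f) Z, which vanishes; the terms
  with one derivative on f and one on Z cancel in pairs.\<close>

lemma curvature_scale:
  assumes "smooth_function A f" and X: "vector_field A X" and Y: "vector_field A Y" and Z: "vector_field A Z"
  shows "curvature A D X Y (\<lambda>p. f p *\<^sub>R Z p) q = f q *\<^sub>R curvature A D X Y Z q"
proof -
  have second: "D U (D V (\<lambda>p. f p *\<^sub>R Z p)) q =
      vf_apply A U (vf_apply A V f) q *\<^sub>R Z q + vf_apply A V f q *\<^sub>R D U Z q
      + vf_apply A U f q *\<^sub>R D V Z q + f q *\<^sub>R D U (D V Z) q"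
    if U: "vector_field A U" and V: "vector_field A V" for U V
    using U V Z assms(1)
    by (simp add: D_scale_right_fun D_add_right_fun vector_field_D vector_field_scaleR smooth_function_vf_apply)
  show ?thesis
    unfolding curvature_def second[OF X Y] second[OF Y X]
      D_scale_right_fun[OF assms(1) vector_field_lie_bracket[OF X Y] Z]
      vf_apply_lie_bracket[OF X Y assms(1)]
    by (simp add: algebra_simps)
qed

lemma linear_curvature:
  assumes "vector_field A X" "vector_field A Y"
  shows "linear (\<lambda>w. curvature A D X Y (extend A q w) q)"
  by (rule linear_tensorial_extend) (simp_all add: curvature_add curvature_scale assms)

text \<open>Linearity lets \<open>riesz\<close> represent Ric(v, .) by a vector, which gives access
  to the scalar curvature.\<close>

lemma linear_ricci: "linear (ricci A D q v)"
proof -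
  have "linear (\<lambda>w. curvature A D (extend A q u) (extend A q v) (extend A q w) q $ i)" for u i
    using linear_compose[OF linear_curvature[OF vector_field_extend[of q u] vector_field_extend[of q v]]
        bounded_linear.linear[OF bounded_linear_vec_nth[of i]]]
    by (simp add: o_def)
  then have "linear (\<lambda>w. \<Sum>i\<in>UNIV. curvature A D (extend A q (axis i 1)) (extend A q v) (extend A q w) q $ i)"
    by (intro linear_compose_sum ballI)
  then show ?thesis by (simp add: ricci_def[abs_def] trace_matrix)
qed

section \<open>The tensor P and the curvature of the semi-symmetric connection\<close>

definition P_endo_field :: "('m \<Rightarrow> real ^ 'n) \<Rightarrow> 'm \<Rightarrow> real ^ 'n" where
  "P_endo_field X q = D X \<rho> q - \<pi> q (X q) *\<^sub>R \<rho> q + (\<pi> q (\<rho> q) / 2) *\<^sub>R X q"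

definition P_endo :: "'m \<Rightarrow> real ^ 'n \<Rightarrow> real ^ 'n" where
  "P_endo q v = P_endo_field (extend A q v) q"

text \<open>Metric compatibility turns (nabla_X \<pi>)(Y) into g(nabla_X \<rho>, Y), so
  \<open>P_endo_field\<close> is L acting on fields.\<close>

lemma P_tensor_eq:
  assumes "vector_field A X" "vector_field A Y"
  shows "P_tensor A g \<rho> D X Y q = g q (P_endo_field X q) (Y q)"
  using metric_compatible[OF assms(1,2) vector_field_rho]
  by (simp add: P_tensor_def form_derivative_def dual_form_def P_endo_field_def metric_simps
      metric_sym[of q "\<rho> q" "Y q"] metric_sym[of q "D X \<rho> q" "Y q"])

lemma P_endo_field_add:
  "vector_field A X \<Longrightarrow> vector_field A Y \<Longrightarrow>
    P_endo_field (\<lambda>p. X p + Y p) q = P_endo_field X q + P_endo_field Y q"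
  by (simp add: P_endo_field_def D_add_left vector_field_rho dual_form_def metric_simps algebra_simps)

lemma P_endo_field_scale:
  "smooth_function A f \<Longrightarrow> vector_field A X \<Longrightarrow>
    P_endo_field (\<lambda>p. f p *\<^sub>R X p) q = f q *\<^sub>R P_endo_field X q"
  by (simp add: P_endo_field_def D_scale_left vector_field_rho dual_form_def metric_simps algebra_simps)

lemma linear_P_endo: "linear (P_endo q)"
  unfolding P_endo_def[abs_def]
  by (rule linear_tensorial_extend) (simp_all add: P_endo_field_add P_endo_field_scale)

lemma P_trace_eq: "P_trace A g \<rho> D q = (\<Sum>i\<in>UNIV. P_endo q (axis i 1) $ i)"
  unfolding P_trace_def
  by (rule metric_trace_eq) (simp add: P_tensor_eq vector_field_extend extend_at P_endo_def)

text \<open>The terms in nabla_X Y and nabla_Y X cancel against the bracket term because nabla is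
  torsion-free, and the first derivatives of Z outside R(X,Y)Z cancel under antisymmetrisation. The
  term -\<pi>(\<rho>) g(Y,Z) X is shared equally between P(Y,Z)X and g(Y,Z)LX: this is the origin of
  the factor 1/2 in P.\<close>

lemma curvature_semi_symmetric:
  assumes X: "vector_field A X" and Y: "vector_field A Y" and Z: "vector_field A Z"
  shows "curvature A D' X Y Z q = curvature A D X Y Z q
    - g q (P_endo_field Y q) (Z q) *\<^sub>R X q + g q (P_endo_field X q) (Z q) *\<^sub>R Y q
    - g q (Y q) (Z q) *\<^sub>R P_endo_field X q + g q (X q) (Z q) *\<^sub>R P_endo_field Y q"
proof -
  note rho = vector_field_rho
  have D'_eq: "D' U V = (\<lambda>q. D U V q + g q (V q) (\<rho> q) *\<^sub>R U q - g q (U q) (V q) *\<^sub>R \<rho> q)" for U V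
    by (simp add: fun_eq_iff semi_symmetric_connection_def dual_form_def)
  \<comment> \<open>The coefficients g(Z,\<rho>) and g(V,Z) are functions, so the product rule
    applies; metric compatibility expresses their derivatives through nabla.\<close>
  have second: "D U (D' V Z) q = D U (D V Z) q
      + (g q (D U Z q) (\<rho> q) + g q (Z q) (D U \<rho> q)) *\<^sub>R V q + g q (Z q) (\<rho> q) *\<^sub>R D U V q
      - (g q (D U V q) (Z q) + g q (V q) (D U Z q)) *\<^sub>R \<rho> q - g q (V q) (Z q) *\<^sub>R D U \<rho> q"
    if U: "vector_field A U" and V: "vector_field A V" for U V
  proof -
    have "vector_field A (\<lambda>q. g q (Z q) (\<rho> q) *\<^sub>R V q)" "vector_field A (\<lambda>q. g q (V q) (Z q) *\<^sub>R \<rho> q)"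
      "vector_field A (\<lambda>q. D V Z q + g q (Z q) (\<rho> q) *\<^sub>R V q)"
      by (intro vector_field_add vector_field_scaleR smooth_function_metric vector_field_D U V Z rho)+
    then show ?thesis
      by (simp add: D'_eq D_diff_right_fun[OF U] D_add_right_fun[OF U] D_scale_right_fun[OF _ U]
          smooth_function_metric vector_field_D metric_compatible[OF U] V Z rho)
  qed
  have expand: "D' U (D' V Z) q = D U (D' V Z) q + g q (D' V Z q) (\<rho> q) *\<^sub>R U q - g q (U q) (D' V Z q) *\<^sub>R \<rho> q" for U V
    by (simp add: semi_symmetric_connection_def dual_form_def)
  have sym: "g q (Y q) (X q) = g q (X q) (Y q)" "g q (D X \<rho> q) (Z q) = g q (Z q) (D X \<rho> q)"
    "g q (D Y \<rho> q) (Z q) = g q (Z q) (D Y \<rho> q)" "g q (\<rho> q) (Z q) = g q (Z q) (\<rho> q)"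
    by (rule metric_sym)+
  show ?thesis
    unfolding curvature_def expand second[OF X Y] second[OF Y X]
    unfolding D'_eq lie_bracket_torsion[OF X Y] P_endo_field_def dual_form_def
    by (simp add: metric_simps vec_eq_iff sym) (simp add: algebra_simps)
qed

text \<open>In the trace over X, -P(Y,Z)X contributes -n P(Y,Z), the rank-one terms P(X,Z)Y and
  g(X,Z)LY give back P(Y,Z) each, whence n - 2, and -g(Y,Z)LX contributes -a g(Y,Z).\<close>

lemma ricci_semi_symmetric:
  "ricci A D' q v w = ricci A D q v w - (real CARD('n) - 2) * g q (P_endo q v) w
    - P_trace A g \<rho> D q * g q v w"
proof -
  let ?e = "\<lambda>i. axis i 1 :: real ^ 'n"
  have "linear (\<lambda>u. g q (P_endo q u) w)"
    using linear_compose[OF linear_P_endo linear_metric_left, unfolded o_def] .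
  note traces = sum_component_linear[OF this, of v] sum_component_linear[OF linear_metric_left, of q w "P_endo q v"]
  have "ricci A D' q v w = (\<Sum>i\<in>UNIV. curvature A D (extend A q (?e i)) (extend A q v) (extend A q w) q $ i
    - g q (P_endo q v) w * ?e i $ i + g q (P_endo q (?e i)) w * v $ i
    - g q v w * P_endo q (?e i) $ i + g q (?e i) w * P_endo q v $ i)"
    by (simp add: ricci_def trace_matrix curvature_semi_symmetric vector_field_extend extend_at
        P_endo_def[symmetric])
  also have "\<dots> = ricci A D q v w - g q (P_endo q v) w * real CARD('n) + g q (P_endo q v) w
    - g q v w * P_trace A g \<rho> D q + g q (P_endo q v) w"
    by (simp add: sum.distrib sum_subtractf traces sum_distrib_left[symmetric] P_trace_eq ricci_def trace_matrix)
  finally show ?thesis by (simp add: algebra_simps)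
qed

text \<open>If R represents Ric, the new Ricci tensor is represented by R - (n-2)L - a Id; as L has
  trace a, the loss is (n-2)a + na.\<close>

lemma scalar_curvature_semi_symmetric:
  "scalar_curvature A g D' q = scalar_curvature A g D q - 2 * (real CARD('n) - 1) * P_trace A g \<rho> D q"
proof -
  let ?a = "P_trace A g \<rho> D q"
  have "\<exists>w. \<forall>v. ricci A D q u v = g q w v" for u
    using riesz[OF linear_ricci] by metis
  then obtain R where R: "\<And>u v. ricci A D q u v = g q (R u) v" by metis
  have "scalar_curvature A g D q = (\<Sum>i\<in>UNIV. R (axis i 1) $ i)"
    unfolding scalar_curvature_def by (rule metric_trace_eq) (rule R)
  moreover have "scalar_curvature A g D' q =
      (\<Sum>i\<in>UNIV. (R (axis i 1) - (real CARD('n) - 2) *\<^sub>R P_endo q (axis i 1) - ?a *\<^sub>R axis i 1) $ i)"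
    unfolding scalar_curvature_def
    by (rule metric_trace_eq) (simp add: ricci_semi_symmetric R metric_simps)
  moreover have "\<dots> = (\<Sum>i\<in>UNIV. R (axis i 1) $ i) - (real CARD('n) - 2) * ?a - ?a * real CARD('n)"
    by (simp add: sum_subtractf sum_distrib_left[symmetric] P_trace_eq)
  ultimately show ?thesis by (simp add: algebra_simps)
qed

lemma soliton_constant:
  assumes sol: "conformal_yamabe_soliton A D' p g \<tau> lam"
    and tf: "torse_forming A D \<tau> \<phi> \<alpha>"
  shows "lam = scalar_curvature A g D q - \<phi> q - 2 * (real CARD('n) - 1) * P_trace A g \<rho> D q
    + 1/2 * (p q + 2 / real CARD('n)) - (real CARD('n) - 1) / real CARD('n) * \<pi> q (\<tau> q)
    - \<alpha> q (\<tau> q) / real CARD('n)"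
proof -
  let ?n = "real CARD('n)"
  define c where "c = 2 * lam - 2 * scalar_curvature A g D' q - (p q + 2 / ?n)"
  have lin: "linear (\<alpha> q)" using tf by (simp add: torse_forming_def one_form_def)
  \<comment> \<open>The dual vector of \<alpha> brings every term into the form g(., v).
    Nondegeneracy then removes v and leaves an endomorphism equal to zero, whose trace can be
    taken.\<close>
  obtain \<beta> where \<beta>: "\<And>v. \<alpha> q v = g q \<beta> v" using riesz[OF lin, of q] by metis
  have tau: "D' (extend A q u) \<tau> q = \<phi> q *\<^sub>R u + \<alpha> q u *\<^sub>R \<tau> q + \<pi> q (\<tau> q) *\<^sub>R u - g q u (\<tau> q) *\<^sub>R \<rho> q" for u
    using tf by (simp add: torse_forming_def semi_symmetric_connection_def vector_field_extend extend_at)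
  have eq: "2 * \<phi> q * g q u v + \<alpha> q u * g q (\<tau> q) v + \<alpha> q v * g q u (\<tau> q) + 2 * \<pi> q (\<tau> q) * g q u v
      - g q u (\<tau> q) * g q (\<rho> q) v - \<pi> q u * g q (\<tau> q) v + c * g q u v = 0" for u v
  proof -
    have "g q (D' (extend A q u) \<tau> q) v + g q u (D' (extend A q v) \<tau> q) + c * g q u v = 0"
      using sol vector_field_extend[of q u] vector_field_extend[of q v]
      unfolding conformal_yamabe_soliton_def lie_derivative_wrt_def c_def by (metis extend_at)
    then show ?thesis
      unfolding tau
      by (simp add: metric_simps dual_form_def metric_sym[of q v "\<tau> q"] metric_sym[of q u "\<rho> q"] algebra_simps)
  qed
  have "g q ((2 * \<phi> q + 2 * \<pi> q (\<tau> q) + c) *\<^sub>R u + (\<alpha> q u - \<pi> q u) *\<^sub>R \<tau> q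
      + g q u (\<tau> q) *\<^sub>R (\<beta> - \<rho> q)) v = 0" for u v
    using eq[of u v] unfolding \<beta> by (simp add: metric_simps algebra_simps)
  then have zero: "(2 * \<phi> q + 2 * \<pi> q (\<tau> q) + c) *\<^sub>R u + (\<alpha> q u - \<pi> q u) *\<^sub>R \<tau> q
      + g q u (\<tau> q) *\<^sub>R (\<beta> - \<rho> q) = 0" for u
    by (rule metric_nondegenerate)
  let ?e = "\<lambda>i. axis i 1 :: real ^ 'n"
  have lin\<pi>: "linear (\<lambda>u. \<alpha> q u - \<pi> q u)"
    using lin linear_metric_left by (auto simp: dual_form_def intro!: linear_compose_sub)
  have "0 = (\<Sum>i\<in>UNIV. ((2 * \<phi> q + 2 * \<pi> q (\<tau> q) + c) *\<^sub>R ?e i + (\<alpha> q (?e i) - \<pi> q (?e i)) *\<^sub>R \<tau> q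
      + g q (?e i) (\<tau> q) *\<^sub>R (\<beta> - \<rho> q)) $ i)"
    by (simp only: zero) simp
  also have "\<dots> = (2 * \<phi> q + 2 * \<pi> q (\<tau> q) + c) * (\<Sum>i\<in>UNIV. ?e i $ i)
      + (\<Sum>i\<in>UNIV. (\<alpha> q (?e i) - \<pi> q (?e i)) * \<tau> q $ i)
      + (\<Sum>i\<in>UNIV. g q (?e i) (\<tau> q) * (\<beta> - \<rho> q) $ i)"
    by (simp only: sum.distrib vector_add_component vector_scaleR_component real_scaleR_def sum_distrib_left)
  also have "\<dots> = (2 * \<phi> q + 2 * \<pi> q (\<tau> q) + c) * ?n + (\<alpha> q (\<tau> q) - \<pi> q (\<tau> q)) + g q (\<beta> - \<rho> q) (\<tau> q)"
    by (simp only: sum_component_linear[OF lin\<pi>] sum_component_linear[OF linear_metric_left] sum_axis_component)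
  also have "g q (\<beta> - \<rho> q) (\<tau> q) = \<alpha> q (\<tau> q) - \<pi> q (\<tau> q)"
    by (simp add: metric_simps \<beta> dual_form_def metric_sym)
  finally have "(2 * \<phi> q + 2 * \<pi> q (\<tau> q) + c) * ?n + 2 * (\<alpha> q (\<tau> q) - \<pi> q (\<tau> q)) = 0" by simp
  then have "2 * \<phi> q + 2 * \<pi> q (\<tau> q) + c = 2 * (\<pi> q (\<tau> q) / ?n) - 2 * (\<alpha> q (\<tau> q) / ?n)"
    by (simp add: field_simps)
  moreover have "(?n - 1) / ?n * \<pi> q (\<tau> q) = \<pi> q (\<tau> q) - \<pi> q (\<tau> q) / ?n"
    by (simp add: field_simps)
  \<comment> \<open>The final rearrangement over bare reals: t is p + 2/n, z is \<pi>(\<tau>)/n, y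
    is \<alpha>(\<tau>)/n, w is (n-1)/n \<pi>(\<tau>), and s - 2 N P is the scalar curvature of the
    semi-symmetric connection.\<close>
  moreover have "lam = s - f - 2 * N * P + 1/2 * t - w - y"
    if "2 * f + 2 * x + (2 * lam - 2 * (s - 2 * N * P) - t) = 2 * z - 2 * y" "w = x - z"
    for s f N P t w x y z :: real
    using that by (simp add: field_simps)
  ultimately show ?thesis
    unfolding c_def scalar_curvature_semi_symmetric by blast
qed

end

theorem theorem3p3:
  fixes A :: "('m::{t2_space, second_countable_topology}, 'n::finite) chart set"
    and g :: "'m \<Rightarrow> real ^ 'n \<Rightarrow> real ^ 'n \<Rightarrow> real"
    and D :: "('m, 'n) connection"
    and \<rho> \<tau> :: "'m \<Rightarrow> real ^ 'n"
    and lam :: real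
    and p \<phi> :: "'m \<Rightarrow> real"
    and \<alpha> :: "'m \<Rightarrow> real ^ 'n \<Rightarrow> real"
  defines "n \<equiv> real CARD('n)"
    and "r \<equiv> scalar_curvature A g D"
    and "a \<equiv> P_trace A g \<rho> D"
    and "\<pi> \<equiv> dual_form g \<rho>"
  defines "E \<equiv> \<lambda>q. r q - \<phi> q - 2 * (n - 1) * a q + 1/2 * (p q + 2 / n)
                 - (n - 1) / n * \<pi> q (\<tau> q) - \<alpha> q (\<tau> q) / n"
  assumes "smooth_atlas A"
    and "pseudo_riemannian_metric A g"
    and "levi_civita A g D"
    and "vector_field A \<rho>"
    and "conformal_yamabe_soliton A (semi_symmetric_connection g \<rho> D) p g \<tau> lam"
    and "torse_forming A D \<tau> \<phi> \<alpha>"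
  shows "E constant_on UNIV \<and>
         (\<forall>q. lam = E q \<and>
           (expanding lam \<longleftrightarrow> E q > 0) \<and>
           (steady lam \<longleftrightarrow> E q = 0) \<and>
           (shrinking lam \<longleftrightarrow> E q < 0))"
proof -
  interpret semi_symmetric A g D \<rho>
    by unfold_locales (fact assms)+
  \<comment> \<open>As lam does not depend on q, this identity yields both the constancy of E and
    the three sign cases.\<close>
  have "E q = lam" for q
    unfolding E_def n_def r_def a_def \<pi>_def
    by (rule soliton_constant[symmetric]) (fact assms)+
  then show ?thesis
    by (auto simp: constant_on_def expanding_def steady_def shrinking_def)
qed

end
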